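(* Let $K\in\mathbb{R}$, let $(X,\mathsf{d},\mathfrak m)$ be an extended metric measure space, and let $\Omega$ be a probability measure on $\mathcal{P}(X)$ with finite variance. Assume that every $\mu\in\mathcal{P}(X)$ which has finite $W_2$-distance to $\mathrm{D}(\mathrm{Ent}_{\mathfrak m})=\{\nu:\mathrm{Ent}_{\mathfrak m}(\nu)<\infty\}$ is the starting point of an $\mathrm{EVI}_K$ gradient flow of $\mathrm{Ent}_{\mathfrak m}$ in the Wasserstein space $(\mathcal{P}(X),W_2)$. Then for every Wasserstein barycenter $\bar\mu$ of $\Omega$, $$\mathrm{Ent}_{\mathfrak m}(\bar\mu)\le \int_{\mathcal{P}(X)}\mathrm{Ent}_{\mathfrak m}(\mu)\,d\Omega(\mu)-\frac K2\int_{\mathcal{P}(X)}W_2^2(\bar\mu,\mu)\,d\Omega(\mu).$$ As a consequence, if $\int_{\mathcal{P}(X)}\mathrm{Ent}_{\mathfrak m}(\mu)\,d\Omega(\mu)<\infty$, then every barycenter of $\Omega$ is absolutely continuous with respect to $\mathfrak m$.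
   Context: An extended metric space $(X,\mathsf{d})$: $\mathsf{d}:X\times X\to[0,+\infty]$ symmetric, satisfying the triangle inequality, with $\mathsf{d}(x,y)=0$ iff $x=y$. An extended metric measure space $(X,\mathsf{d},\mathfrak m)$: $X$ carries a Hausdorff topology $\tau$ such that $(X,\tau,\mathsf{d})$ is an extended metric-topological space in the sense of Ambrosio–Erbar–Savaré (compatibility of $\tau$ and $\mathsf{d}$), $(X,\mathsf{d})$ is complete, and $\mathfrak m$ is a nonnegative Radon probability measure on the Borel sets of $\tau$ with full support. $\mathcal{P}(X)$ is the set of Radon probability measures on $X$, with the (extended) quadratic Wasserstein distance $W_2^2(\mu,\nu)=\inf_{\pi}\int \mathsf{d}^2(x,y)\,d\pi(x,y)$, infimum over couplings $\pi$ of $\mu,\nu$. $\mathcal P(X)$ is endowed with a Hausdorff topology making it an extended metric-topological space with $W_2$, singletons measurable, and $\Omega$ is a Radon probability measure on it. $\Omega$ has finite variance if $\mathrm{Var}(\Omega):=\inf_{\nu\in\mathcal P(X)}\int W_2^2(\mu,\nu)\,d\Omega(\mu)<\infty$; a Wasserstein barycenter of $\Omega$ is a $\bar\nu\in\mathcal P(X)$ attaining this infimum. Relative entropy: $\mathrm{Ent}_{\mathfrak m}(\mu)=\int\rho\ln\rho\,d\mathfrak m$ if $\mu=\rho\mathfrak m$, $+\infty$ otherwise. $\mathrm{EVI}_K$ gradient flow of a lower semicontinuous $E:Y\to\mathbb{R}\cup\{+\infty\}$ on an extended metric space $(Y,\mathsf{d}_Y)$ starting at $y_0$: a locally absolutely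 continuous curve $(0,\infty)\ni t\mapsto y_t$ with $y_t\to y_0$ in $\mathsf{d}_Y$ as $t\to0$, such that for every $z\in\mathrm{D}(E)=\{E<\infty\}$ with $\mathsf{d}_Y(z,y_t)<\infty$ for some (hence all) $t>0$, $\frac12\frac{d}{dt}\mathsf{d}_Y^2(y_t,z)+\frac K2\mathsf{d}_Y^2(y_t,z)\le E(z)-E(y_t)$ for a.e. $t>0$; if $y_0\notin\mathrm D(E)$ one requires instead $\liminf_{t\downarrow0}E(y_t)\ge E(y_0)$ and $\mathsf{d}_Y(y_t,y)\to\mathsf{d}_Y(y_0,y)$ for all $y\in\overline{\mathrm D(E)}$. *)

theory Defs
  imports "HOL-Probability.Probability"
begin

definition borel_of :: "'a topology \<Rightarrow> 'a measure" where
  "borel_of T = sigma (topspace T) {U. openin T U}"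

definition radon_prob :: "'a topology \<Rightarrow> 'a measure \<Rightarrow> bool" where
  "radon_prob T M \<longleftrightarrow> prob_space M \<and> sets M = sets (borel_of T) \<and>
     (\<forall>B\<in>sets M. emeasure M B = (SUP C\<in>{C. compactin T C \<and> C \<subseteq> B}. emeasure M C))"

definition ext_metric :: "'a set \<Rightarrow> ('a \<Rightarrow> 'a \<Rightarrow> ennreal) \<Rightarrow> bool" where
  "ext_metric S d \<longleftrightarrow>
     (\<forall>x\<in>S. \<forall>y\<in>S. d x y = d y x) \<and>
     (\<forall>x\<in>S. \<forall>y\<in>S. d x y = 0 \<longleftrightarrow> x = y) \<and>
     (\<forall>x\<in>S. \<forall>y\<in>S. \<forall>z\<in>S. d x z \<le> d x y + d y z)"

definition lip_b :: "'a topology \<Rightarrow> ('a \<Rightarrow> 'a \<Rightarrow> ennreal) \<Rightarrow> real \<Rightarrow> ('a \<Rightarrow> real) set" where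
  "lip_b T d L = {f. continuous_map T euclideanreal f \<and> bounded (f ` topspace T) \<and>
     (\<forall>x\<in>topspace T. \<forall>y\<in>topspace T. ennreal \<bar>f x - f y\<bar> \<le> ennreal L * d x y)}"

definition Lip_b :: "'a topology \<Rightarrow> ('a \<Rightarrow> 'a \<Rightarrow> ennreal) \<Rightarrow> ('a \<Rightarrow> real) set" where
  "Lip_b T d = (\<Union>L. lip_b T d L)"

text \<open>Extended metric-topological space in the sense of Ambrosio--Erbar--Savare:
  Hausdorff topology, extended distance, T is the initial topology of Lip_b(X,T,d),
  and d is recovered as a supremum over 1-Lipschitz functions in Lip_b.\<close>
definition emt_space :: "'a topology \<Rightarrow> ('a \<Rightarrow> 'a \<Rightarrow> ennreal) \<Rightarrow> bool" where
  "emt_space T d \<longleftrightarrow>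
     Hausdorff_space T \<and> ext_metric (topspace T) d \<and>
     T = topology_generated_by
           {{x \<in> topspace T. f x \<in> U} | f U. f \<in> Lip_b T d \<and> open U} \<and>
     (\<forall>x\<in>topspace T. \<forall>y\<in>topspace T.
        d x y = (SUP f\<in>lip_b T d 1. ennreal \<bar>f x - f y\<bar>))"

definition ext_complete :: "'a set \<Rightarrow> ('a \<Rightarrow> 'a \<Rightarrow> ennreal) \<Rightarrow> bool" where
  "ext_complete S d \<longleftrightarrow>
     (\<forall>s. (\<forall>n. s n \<in> S) \<and> (\<forall>e>0. \<exists>N. \<forall>m\<ge>N. \<forall>n\<ge>N. d (s m) (s n) < ennreal e)
          \<longrightarrow> (\<exists>x\<in>S. (\<lambda>n. d (s n) x) \<longlonglongrightarrow> 0))"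

definition emm_space :: "'a topology \<Rightarrow> ('a \<Rightarrow> 'a \<Rightarrow> ennreal) \<Rightarrow> 'a measure \<Rightarrow> bool" where
  "emm_space T d m \<longleftrightarrow> emt_space T d \<and> ext_complete (topspace T) d \<and> radon_prob T m \<and>
     (\<forall>U. openin T U \<and> U \<noteq> {} \<longrightarrow> emeasure m U > 0)"

definition Pspace :: "'a topology \<Rightarrow> 'a measure set" where
  "Pspace T = {\<mu>. radon_prob T \<mu>}"

definition couplings :: "'a topology \<Rightarrow> 'a measure \<Rightarrow> 'a measure \<Rightarrow> ('a \<times> 'a) measure set" where
  "couplings T \<mu> \<nu> = {\<pi>. radon_prob (prod_topology T T) \<pi> \<and>
     (\<forall>A\<in>sets (borel_of T). emeasure \<pi> (A \<times> topspace T) = emeasure \<mu> A \<and>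
                            emeasure \<pi> (topspace T \<times> A) = emeasure \<nu> A)}"

definition W2sq :: "'a topology \<Rightarrow> ('a \<Rightarrow> 'a \<Rightarrow> ennreal) \<Rightarrow> 'a measure \<Rightarrow> 'a measure \<Rightarrow> ennreal" where
  "W2sq T d \<mu> \<nu> = (INF \<pi>\<in>couplings T \<mu> \<nu>. \<integral>\<^sup>+ p. (d (fst p) (snd p))\<^sup>2 \<partial>\<pi>)"

definition W2 :: "'a topology \<Rightarrow> ('a \<Rightarrow> 'a \<Rightarrow> ennreal) \<Rightarrow> 'a measure \<Rightarrow> 'a measure \<Rightarrow> ennreal" where
  "W2 T d \<mu> \<nu> = (if W2sq T d \<mu> \<nu> = \<infinity> then \<infinity> else ennreal (sqrt (enn2real (W2sq T d \<mu> \<nu>))))"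

definition variance :: "'a topology \<Rightarrow> ('a \<Rightarrow> 'a \<Rightarrow> ennreal) \<Rightarrow> 'a measure measure \<Rightarrow> ennreal" where
  "variance T d \<Omega> = (INF \<nu>\<in>Pspace T. \<integral>\<^sup>+ \<mu>. W2sq T d \<mu> \<nu> \<partial>\<Omega>)"

definition barycenter :: "'a topology \<Rightarrow> ('a \<Rightarrow> 'a \<Rightarrow> ennreal) \<Rightarrow> 'a measure measure \<Rightarrow> 'a measure \<Rightarrow> bool" where
  "barycenter T d \<Omega> \<nu> \<longleftrightarrow> \<nu> \<in> Pspace T \<and> (\<integral>\<^sup>+ \<mu>. W2sq T d \<mu> \<nu> \<partial>\<Omega>) = variance T d \<Omega>"

definition ereal_integral :: "'b measure \<Rightarrow> ('b \<Rightarrow> ereal) \<Rightarrow> ereal" where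
  "ereal_integral M f = enn2ereal (\<integral>\<^sup>+ x. e2ennreal (f x) \<partial>M) - enn2ereal (\<integral>\<^sup>+ x. e2ennreal (- f x) \<partial>M)"

definition Ent :: "'a measure \<Rightarrow> 'a measure \<Rightarrow> ereal" where
  "Ent m \<mu> = (if sets \<mu> = sets m \<and> absolutely_continuous m \<mu>
     then ereal_integral m (\<lambda>x. let \<rho> = enn2real (RN_deriv m \<mu> x) in ereal (\<rho> * ln \<rho>))
     else \<infinity>)"

definition loc_abs_cont :: "('b \<Rightarrow> 'b \<Rightarrow> ennreal) \<Rightarrow> (real \<Rightarrow> 'b) \<Rightarrow> bool" where
  "loc_abs_cont dY y \<longleftrightarrow>
     (\<forall>a b. 0 < a \<and> a \<le> b \<longrightarrow>
        (\<exists>g. set_integrable lborel {a..b} g \<and>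
             (\<forall>s t. a \<le> s \<and> s \<le> t \<and> t \<le> b \<longrightarrow>
                 dY (y s) (y t) \<le> ennreal (set_lebesgue_integral lborel {s..t} g))))"

definition dom_E :: "'b set \<Rightarrow> ('b \<Rightarrow> ereal) \<Rightarrow> 'b set" where
  "dom_E Y E = {z\<in>Y. E z < \<infinity>}"

definition dclosure :: "'b set \<Rightarrow> ('b \<Rightarrow> 'b \<Rightarrow> ennreal) \<Rightarrow> 'b set \<Rightarrow> 'b set" where
  "dclosure Y dY A = {x\<in>Y. \<forall>e>0. \<exists>z\<in>A. dY x z < ennreal e}"

definition EVI_flow :: "'b set \<Rightarrow> ('b \<Rightarrow> 'b \<Rightarrow> ennreal) \<Rightarrow> ('b \<Rightarrow> ereal) \<Rightarrow> real \<Rightarrow> 'b \<Rightarrow> (real \<Rightarrow> 'b) \<Rightarrow> bool" where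
  "EVI_flow Y dY E K y0 y \<longleftrightarrow>
     (\<forall>t>0. y t \<in> Y) \<and> loc_abs_cont dY y \<and>
     (if y0 \<in> dom_E Y E
      then ((\<lambda>t. dY (y t) y0) \<longlongrightarrow> 0) (at_right 0)
      else (E y0 \<le> Liminf (at_right 0) (\<lambda>t. E (y t)) \<and>
            (\<forall>z\<in>dclosure Y dY (dom_E Y E). ((\<lambda>t. dY (y t) z) \<longlongrightarrow> dY y0 z) (at_right 0)))) \<and>
     (\<forall>z\<in>dom_E Y E. (\<exists>t>0. dY z (y t) < \<infinity>) \<longrightarrow>
        (AE t in lborel. t > 0 \<longrightarrow>
           (\<exists>D. ((\<lambda>s. (enn2real (dY (y s) z))\<^sup>2) has_real_derivative D) (at t) \<and>
                ereal (D / 2 + K / 2 * (enn2real (dY (y t) z))\<^sup>2) \<le> E z - E (y t))))"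

end

theory Submission
  imports Defs
begin

text \<open>Let \<open>y\<close> be the \<open>EVI\<close> flow started at the barycenter. Integrating the variational inequality against
  \<open>z\<close> in time gives, with \<open>J(t) = \<integral> exp (K s) ds\<close> over \<open>[0, t]\<close> and any lower bound \<open>c\<close> of the entropy
  along \<open>y\<close> on \<open>(0, t)\<close>,
  \<open>exp (K t) W2(y t, z)^2 / 2 + c J(t) \<le> W2(y 0, z)^2 / 2 + Ent(z) J(t)\<close>.
  Integrating over \<open>z\<close>, both squared distances are compared with the variance: the right one equals it because
  \<open>y 0\<close> is a barycenter, and the left one is at least it. Since \<open>exp (K t) - 1 = K J(t)\<close>, dividing by
  \<open>J(t)\<close> leaves \<open>c \<le> \<integral> Ent - K/2 Var\<close>. As \<open>t\<close> tends to 0, \<open>c\<close> may approach the entropy of the barycenter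
  by lower semicontinuity. For a starting point in the domain this is not part of the definition of the flow; it
  follows from the dual formula for the entropy, tested with bounded Lipschitz functions.\<close>

section \<open>Absolutely continuous functions on an interval\<close>

text \<open>The variational inequality holds only at almost every time, and the energy along the
  flow is not known to be integrable in time. Putting the constant c in its place before integrating
  removes the second difficulty. The first is met by a direct proof that an absolutely continuous
  function whose derivative is nonpositive almost everywhere does not increase. The flow is
  absolutely continuous only away from time 0, so estimates start at some s > 0 and s is then sent
  to 0.

  The hypothesis supplies a flow only from measures at finite distance from the domain of the
  entropy. For the barycenter this is forced by finite variance together with a finite integral of
  the entropy; if that integral is infinite, the bound is trivial.

  As \<open>m\<close> is a probability measure, the entropy is nonnegative. The integration over z
  can then be carried out in \<open>ennreal\<close>, where infinite distances and entropies are
  harmless as long as nothing is subtracted.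

  Convergence in \<open>W2\<close> controls integrals of Lipschitz test functions only. These are
  enough for the dual formula because they generate the topology and the measures are inner regular,
  which makes them dense in L1.\<close>

definition ac_on :: "real \<Rightarrow> real \<Rightarrow> (real \<Rightarrow> real) \<Rightarrow> bool" where
  "ac_on a b F \<longleftrightarrow> (\<exists>h. set_integrable lborel {a..b} h \<and> (\<forall>x. 0 \<le> h x) \<and>
     (\<forall>s t. a \<le> s \<longrightarrow> s \<le> t \<longrightarrow> t \<le> b \<longrightarrow> \<bar>F t - F s\<bar> \<le> set_lebesgue_integral lborel {s..t} h))"

lemma ac_on_lipschitz:
  assumes "\<And>s t. a \<le> s \<Longrightarrow> s \<le> t \<Longrightarrow> t \<le> b \<Longrightarrow> \<bar>F t - F s\<bar> \<le> L * (t - s)"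
  shows "ac_on a b F"
proof -
  have "\<bar>F t - F s\<bar> \<le> set_lebesgue_integral lborel {s..t} (\<lambda>_. \<bar>L\<bar>)" 
    if "a \<le> s" "s \<le> t" "t \<le> b" for s t
  proof -
    have "\<bar>F t - F s\<bar> \<le> L * (t - s)" using assms that by simp
    also have "\<dots> \<le> \<bar>L\<bar> * (t - s)" using that by (intro mult_right_mono) auto
    finally show ?thesis using that by (simp add: set_integral_const mult.commute)
  qed
  moreover have "set_integrable lborel {a..b} (\<lambda>_. \<bar>L\<bar>)"
    by (auto simp: set_integrable_def integrable_indicator_iff emeasure_lborel_Icc_eq)
  ultimately show ?thesis unfolding ac_on_def by (intro exI[of _ "\<lambda>_. \<bar>L\<bar>"]) auto
qed

lemma ac_on_add:
  assumes "ac_on a b F" "ac_on a b G"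
  shows "ac_on a b (\<lambda>t. F t + G t)"
proof -
  obtain h where h: "set_integrable lborel {a..b} h" "\<And>x. 0 \<le> h x"
    "\<And>s t. a \<le> s \<Longrightarrow> s \<le> t \<Longrightarrow> t \<le> b \<Longrightarrow> \<bar>F t - F s\<bar> \<le> set_lebesgue_integral lborel {s..t} h"
    using assms(1) unfolding ac_on_def by blast
  obtain k where k: "set_integrable lborel {a..b} k" "\<And>x. 0 \<le> k x"
    "\<And>s t. a \<le> s \<Longrightarrow> s \<le> t \<Longrightarrow> t \<le> b \<Longrightarrow> \<bar>G t - G s\<bar> \<le> set_lebesgue_integral lborel {s..t} k"
    using assms(2) unfolding ac_on_def by blast
  have "\<bar>(F t + G t) - (F s + G s)\<bar> \<le> set_lebesgue_integral lborel {s..t} (\<lambda>x. h x + k x)"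
    if st: "a \<le> s" "s \<le> t" "t \<le> b" for s t
  proof -
    have "set_integrable lborel {s..t} h" "set_integrable lborel {s..t} k"
      using h(1) k(1) st by (auto intro: set_integrable_subset)
    hence "set_lebesgue_integral lborel {s..t} (\<lambda>x. h x + k x)
      = set_lebesgue_integral lborel {s..t} h + set_lebesgue_integral lborel {s..t} k" by simp
    with h(3)[OF st] k(3)[OF st] show ?thesis by linarith
  qed
  thus ?thesis unfolding ac_on_def using h k
    by (intro exI[of _ "\<lambda>x. h x + k x"]) (auto intro!: add_nonneg_nonneg set_integral_add)
qed

lemma ac_on_bounded:
  assumes "ac_on a b F"
  obtains B where "0 \<le> B" "\<And>t. a \<le> t \<Longrightarrow> t \<le> b \<Longrightarrow> \<bar>F t\<bar> \<le> B"
proof -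
  obtain h where h: "set_integrable lborel {a..b} h" "\<And>x. 0 \<le> h x"
    "\<And>s t. a \<le> s \<Longrightarrow> s \<le> t \<Longrightarrow> t \<le> b \<Longrightarrow> \<bar>F t - F s\<bar> \<le> set_lebesgue_integral lborel {s..t} h"
    using assms(1) unfolding ac_on_def by blast
  have "\<bar>F t\<bar> \<le> \<bar>F a\<bar> + set_lebesgue_integral lborel {a..b} h" if "a \<le> t" "t \<le> b" for t
  proof -
    have "\<bar>F t - F a\<bar> \<le> set_lebesgue_integral lborel {a..t} h" using h(3)[of a t] that by simp
    also have "\<dots> \<le> set_lebesgue_integral lborel {a..b} h"
    proof -
      have "set_integrable lborel {a..t} h" using h(1) that by (auto intro: set_integrable_subset)
      thus ?thesis using h that unfolding set_lebesgue_integral_def set_integrable_def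
        by (intro integral_mono) (auto simp: indicator_def)
    qed
    finally show ?thesis by linarith
  qed
  moreover have "0 \<le> \<bar>F a\<bar> + set_lebesgue_integral lborel {a..b} h"
    using h by (auto simp: set_lebesgue_integral_def intro!: add_nonneg_nonneg integral_nonneg_AE)
  ultimately show ?thesis using that by blast
qed

lemma ac_on_mult:
  assumes "ac_on a b F" "ac_on a b G"
  shows "ac_on a b (\<lambda>t. F t * G t)"
proof -
  obtain h where h: "set_integrable lborel {a..b} h" "\<And>x. 0 \<le> h x"
    "\<And>s t. a \<le> s \<Longrightarrow> s \<le> t \<Longrightarrow> t \<le> b \<Longrightarrow> \<bar>F t - F s\<bar> \<le> set_lebesgue_integral lborel {s..t} h"
    using assms(1) unfolding ac_on_def by blast
  obtain k where k: "set_integrable lborel {a..b} k" "\<And>x. 0 \<le> k x"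
    "\<And>s t. a \<le> s \<Longrightarrow> s \<le> t \<Longrightarrow> t \<le> b \<Longrightarrow> \<bar>G t - G s\<bar> \<le> set_lebesgue_integral lborel {s..t} k"
    using assms(2) unfolding ac_on_def by blast
  obtain B where B: "0 \<le> B" "\<And>t. a \<le> t \<Longrightarrow> t \<le> b \<Longrightarrow> \<bar>F t\<bar> \<le> B"
    using ac_on_bounded[OF assms(1)] by blast
  obtain C where C: "0 \<le> C" "\<And>t. a \<le> t \<Longrightarrow> t \<le> b \<Longrightarrow> \<bar>G t\<bar> \<le> C"
    using ac_on_bounded[OF assms(2)] by blast
  have "\<bar>F t * G t - F s * G s\<bar> \<le> set_lebesgue_integral lborel {s..t} (\<lambda>x. C * h x + B * k x)"
    if st: "a \<le> s" "s \<le> t" "t \<le> b" for s t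
  proof -
    have "set_integrable lborel {s..t} h" "set_integrable lborel {s..t} k"
      using h(1) k(1) st by (auto intro: set_integrable_subset)
    hence eq: "set_lebesgue_integral lborel {s..t} (\<lambda>x. C * h x + B * k x)
      = C * set_lebesgue_integral lborel {s..t} h + B * set_lebesgue_integral lborel {s..t} k" by simp
    have "F t * G t - F s * G s = G t * (F t - F s) + F s * (G t - G s)" by (simp add: algebra_simps)
    also have "\<bar>\<dots>\<bar> \<le> \<bar>G t\<bar> * \<bar>F t - F s\<bar> + \<bar>F s\<bar> * \<bar>G t - G s\<bar>"
      by (metis abs_mult abs_triangle_ineq)
    also have "\<dots> \<le> C * set_lebesgue_integral lborel {s..t} h + B * set_lebesgue_integral lborel {s..t} k"
      using B C st h(3)[OF st] k(3)[OF st] by (intro add_mono mult_mono) auto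
    finally show ?thesis using eq by simp
  qed
  thus ?thesis unfolding ac_on_def using h k B(1) C(1)
    by (intro exI[of _ "\<lambda>x. C * h x + B * k x"]) (auto intro!: add_nonneg_nonneg set_integral_add)
qed

lemma ac_on_C1:
  assumes "\<And>t. a \<le> t \<Longrightarrow> t \<le> b \<Longrightarrow> (F has_real_derivative F' t) (at t)"
    and "continuous_on {a..b} F'"
  shows "ac_on a b F"
proof -
  have "compact (F' ` {a..b})" using assms(2) by (intro compact_continuous_image) auto
  then obtain L where L: "\<And>t. t \<in> {a..b} \<Longrightarrow> \<bar>F' t\<bar> \<le> L"
    using compact_imp_bounded bounded_iff by (metis imageI real_norm_def)
  show ?thesis
  proof (rule ac_on_lipschitz)
    fix s t assume st: "a \<le> s" "s \<le> t" "t \<le> b"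
    show "\<bar>F t - F s\<bar> \<le> L * (t - s)"
    proof (cases "s = t")
      case False
      then obtain z where z: "s < z" "z < t" "F t - F s = (t - s) * F' z"
        using MVT2[of s t F F'] st assms(1) by (metis le_less less_le_trans order_trans)
      have "\<bar>F' z\<bar> \<le> L" using L z st by simp
      with z st show ?thesis by (simp add: abs_mult mult.commute mult_right_mono)
    qed simp
  qed
qed

text \<open>Points with a nonpositive derivative allow a growth of at most \<open>r\<close> per unit
  length. The remaining points form a null set, and the growth there is charged to the measure with
  density \<open>h\<close>, which is small on a suitable open neighbourhood of that set.\<close>

lemma ac_on_nonincreasing:
  assumes ab: "a \<le> b" and ac: "ac_on a b F"
    and der: "AE t in lborel. a \<le> t \<longrightarrow> t \<le> b \<longrightarrow> (\<exists>D\<le>0. (F has_real_derivative D) (at t))"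
  shows "F b \<le> F a"
proof (rule field_le_epsilon)
  fix e :: real assume e: "0 < e"
  \<comment> \<open>Chosen so that slope \<open>r\<close> over the whole interval plus a mass of at
    most \<open>r\<close> on the exceptional neighbourhood add up to \<open>e\<close>.\<close>
  define r where "r = e / (b - a + 1)"
  have r_eq: "r * (b - a + 1) = e" using ab by (simp add: r_def)
  have r: "0 < r" "r * (b - a) + r = e"
    using e ab by (simp add: r_def) (use r_eq in \<open>simp only: distrib_left mult_1_right\<close>)
  obtain h where h: "set_integrable lborel {a..b} h" "\<And>x. 0 \<le> h x"
    "\<And>s t. a \<le> s \<Longrightarrow> s \<le> t \<Longrightarrow> t \<le> b \<Longrightarrow> \<bar>F t - F s\<bar> \<le> set_lebesgue_integral lborel {s..t} h"
    using ac unfolding ac_on_def by blast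
  \<comment> \<open>This finite Borel measure dominates the increments of \<open>F\<close>. It
    vanishes on Lebesgue null sets, so outer regularity provides an open set \<open>U\<close> of
    small mass around the exceptional set.\<close>
  define M where "M = density lborel (\<lambda>x. ennreal (indicator {a..b} x * h x))"
  have hi: "integrable lborel (\<lambda>x. indicator {a..b} x * h x)"
    using h(1) by (simp add: set_integrable_def)
  have [measurable]: "(\<lambda>x. indicator {a..b} x * h x) \<in> borel_measurable lborel"
    using hi by auto
  have sM[simp]: "sets M = sets borel" by (simp add: M_def)
  have finM: "finite_measure M"
    using hi h(2) by (intro finite_measureI) (auto simp: M_def emeasure_density nn_integral_eq_integral)
  interpret M: finite_measure M by fact
  have M_int: "measure M {s<..t} = set_lebesgue_integral lborel {s..t} h"
    if st: "a \<le> s" "s \<le> t" "t \<le> b" for s t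
  proof -
    have "emeasure M {s<..t} = (\<integral>\<^sup>+x. ennreal (indicator {a..b} x * h x) * indicator {s<..t} x \<partial>lborel)"
      unfolding M_def by (rule emeasure_density) auto
    also have "\<dots> = (\<integral>\<^sup>+x. ennreal (indicator {s..t} x * h x) \<partial>lborel)"
      using AE_lborel_singleton[of s] st
      by (intro nn_integral_cong_AE) (auto elim!: eventually_mono simp: indicator_def)
    also have "\<dots> = ennreal (set_lebesgue_integral lborel {s..t} h)"
    proof -
      have "set_integrable lborel {s..t} h" using h(1) st by (auto intro: set_integrable_subset)
      thus ?thesis unfolding set_lebesgue_integral_def set_integrable_def using h(2)
        by (subst nn_integral_eq_integral) auto
    qed
    finally show ?thesis
      using h(2) by (simp add: measure_def set_lebesgue_integral_def)
  qed
  obtain N where N: "N \<in> null_sets lborel"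
    "\<And>t. t \<notin> N \<Longrightarrow> a \<le> t \<Longrightarrow> t \<le> b \<Longrightarrow> \<exists>D\<le>0. (F has_real_derivative D) (at t)"
    by (rule AE_E3[OF der]) simp
  have "emeasure M N = 0"
    using N(1) absolutely_continuousI_density[of "\<lambda>x. ennreal (indicator {a..b} x * h x)" lborel]
    unfolding M_def absolutely_continuous_def by (auto simp: null_sets_def)
  moreover have "emeasure M N = (INF U\<in>{U. N \<subseteq> U \<and> open U}. emeasure M U)"
    using N(1) by (intro outer_regular) (auto simp: null_sets_def M.emeasure_finite)
  ultimately have "(INF U\<in>{U. N \<subseteq> U \<and> open U}. emeasure M U) < ennreal r" using r by simp
  then obtain U where U: "N \<subseteq> U" "open U" "emeasure M U < ennreal r"
    by (auto simp: INF_less_iff)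
  have mU: "measure M U < r" using U(3) by (simp add: M.emeasure_eq_measure ennreal_less_iff)
  \<comment> \<open>The bound is additive over adjacent intervals, exactly so because half-open
    intervals are used; by bisection it only has to be checked on short intervals around each
    point.\<close>
  define P where "P = (\<lambda>s t. a \<le> s \<longrightarrow> s \<le> t \<longrightarrow> t \<le> b \<longrightarrow> F t - F s \<le> r * (t - s) + measure M (U \<inter> {s<..t}))"
  have "P a b"
  proof (rule Bolzano[OF ab])
    fix s t u assume P: "P s t" "P t u" "s \<le> t" "t \<le> u"
    show "P s u" unfolding P_def
    proof (intro impI)
      assume "a \<le> s" "s \<le> u" "u \<le> b"
      have "U \<inter> {s<..u} = (U \<inter> {s<..t}) \<union> (U \<inter> {t<..u})" using P by auto
      hence "measure M (U \<inter> {s<..u}) = measure M (U \<inter> {s<..t}) + measure M (U \<inter> {t<..u})"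
        using U(2) by (simp, subst M.finite_measure_Union) auto
      thus "F u - F s \<le> r * (u - s) + measure M (U \<inter> {s<..u})"
        using P \<open>a \<le> s\<close> \<open>u \<le> b\<close> unfolding P_def by (auto simp: algebra_simps)
    qed
  next
    fix x assume x: "a \<le> x" "x \<le> b"
    show "\<exists>d>0. \<forall>s t. s \<le> x \<and> x \<le> t \<and> t - s < d \<longrightarrow> P s t"
    proof (cases "x \<in> U")
      case True
      then obtain d where d: "d > 0" "ball x d \<subseteq> U" using U(2) open_contains_ball by blast
      have "P s t" if st: "s \<le> x" "x \<le> t" "t - s < d" for s t
        unfolding P_def
      proof (intro impI)
        assume "a \<le> s" "s \<le> t" "t \<le> b"
        have "{s<..t} \<subseteq> ball x d" using st by (auto simp: dist_real_def)
        hence "U \<inter> {s<..t} = {s<..t}" using d by auto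
        hence "measure M (U \<inter> {s<..t}) = set_lebesgue_integral lborel {s..t} h"
          using M_int \<open>a \<le> s\<close> \<open>s \<le> t\<close> \<open>t \<le> b\<close> by simp
        moreover have "F t - F s \<le> set_lebesgue_integral lborel {s..t} h"
          using h(3)[of s t] \<open>a \<le> s\<close> \<open>s \<le> t\<close> \<open>t \<le> b\<close> by linarith
        moreover have "0 \<le> r * (t - s)" using r \<open>s \<le> t\<close> by simp
        ultimately show "F t - F s \<le> r * (t - s) + measure M (U \<inter> {s<..t})" by linarith
      qed
      thus ?thesis using d(1) by blast
    next
      case False
      then obtain D where D: "D \<le> 0" "(F has_real_derivative D) (at x)" using N(2) x U(1) by blast
      from D(2) have "(F has_derivative (\<lambda>h. D * h)) (at x)" by (simp add: has_field_derivative_def)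
      then obtain d where d: "d > 0" "\<And>y. norm (y - x) < d \<Longrightarrow>
          norm (F y - F x - D * (y - x)) \<le> r * norm (y - x)"
        unfolding has_derivative_at_alt using r(1) by blast
      have "P s t" if st: "s \<le> x" "x \<le> t" "t - s < d" for s t
        unfolding P_def
      proof (intro impI)
        have "\<bar>F t - F x - D * (t - x)\<bar> \<le> r * (t - x)" "\<bar>F s - F x - D * (s - x)\<bar> \<le> r * (x - s)"
          using d(2)[of t] d(2)[of s] st by auto
        moreover have "D * (t - x) \<le> 0" "D * (s - x) \<ge> 0"
          using D(1) st by (auto simp: mult_nonpos_nonneg mult_nonpos_nonpos)
        moreover have "r * (t - s) = r * (t - x) + r * (x - s)" by (simp add: algebra_simps)
        moreover have "0 \<le> measure M (U \<inter> {s<..t})" by simp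
        ultimately show "F t - F s \<le> r * (t - s) + measure M (U \<inter> {s<..t})" by linarith
      qed
      thus ?thesis using d(1) by blast
    qed
  qed
  hence "F b - F a \<le> r * (b - a) + measure M (U \<inter> {a<..b})" using ab by (simp add: P_def)
  also have "measure M (U \<inter> {a<..b}) \<le> measure M U"
    using U(2) by (intro M.finite_measure_mono) auto
  finally show "F b \<le> F a + e" using mU r by linarith
qed

section \<open>The integrated evolution variational inequality\<close>

definition exp_primitive :: "real \<Rightarrow> real \<Rightarrow> real" where
  "exp_primitive K t = (if K = 0 then t else (exp (K * t) - 1) / K)"

lemma exp_primitive_mult: "K * exp_primitive K t = exp (K * t) - 1"
  by (simp add: exp_primitive_def)

lemma exp_primitive_pos: "0 < t \<Longrightarrow> 0 < exp_primitive K t"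
  by (auto simp: exp_primitive_def zero_less_divide_iff mult_less_0_iff zero_less_mult_iff)

lemma exp_primitive_deriv: "(exp_primitive K has_real_derivative exp (K * t)) (at t)"
proof (cases "K = 0")
  case True
  then show ?thesis by (auto simp: exp_primitive_def[abs_def])
next
  case False
  then show ?thesis
    by (auto simp: exp_primitive_def[abs_def] intro!: derivative_eq_intros)
qed

lemma exp_primitive_tendsto_0: "(exp_primitive K \<longlongrightarrow> 0) (at_right 0)"
proof -
  have "isCont (exp_primitive K) 0" using exp_primitive_deriv DERIV_isCont by blast
  hence "(exp_primitive K \<longlongrightarrow> exp_primitive K 0) (at_right 0)"
    by (simp add: isCont_def filterlim_at_split)
  moreover have "exp_primitive K 0 = 0" by (simp add: exp_primitive_def)
  ultimately show ?thesis by simp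
qed

text \<open>The definition of a flow states its initial condition in two different ways. For a start
  in the domain, the triangle inequality squeezes the distance to \<open>z\<close>; for any other
  start, \<open>z\<close> is itself a point of the closure of the domain.\<close>

lemma EVI_flow_dist_tendsto:
  assumes em: "ext_metric Y dY" and y0: "y0 \<in> Y" and flow: "EVI_flow Y dY E K y0 y"
    and z: "z \<in> dom_E Y E" and fin: "dY y0 z < \<infinity>"
  shows "((\<lambda>t. dY (y t) z) \<longlongrightarrow> dY y0 z) (at_right 0)"
proof (cases "y0 \<in> dom_E Y E")
  case True
  have yY: "y t \<in> Y" if "t > 0" for t using flow that by (simp add: EVI_flow_def)
  have zY: "z \<in> Y" using z by (simp add: dom_E_def)
  have lim: "((\<lambda>t. dY (y t) y0) \<longlongrightarrow> 0) (at_right 0)"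
    using flow True by (simp add: EVI_flow_def)
  have ev: "eventually (\<lambda>t::real. t > 0) (at_right 0)" by (simp add: eventually_at_right_less)
  show ?thesis
  proof (rule tendsto_sandwich)
    show "((\<lambda>t. dY y0 z - dY (y t) y0) \<longlongrightarrow> dY y0 z) (at_right 0)"
      using tendsto_diff_ennreal[OF tendsto_const lim, of "dY y0 z"] fin by simp
    show "((\<lambda>t. dY (y t) y0 + dY y0 z) \<longlongrightarrow> dY y0 z) (at_right 0)"
      using tendsto_add[OF lim tendsto_const, of "dY y0 z"] by simp
    show "\<forall>\<^sub>F t in at_right 0. dY (y t) z \<le> dY (y t) y0 + dY y0 z"
      using ev
    proof eventually_elim
      case (elim t)
      show ?case using em yY[OF elim] zY y0 unfolding ext_metric_def by blast
    qed
    show "\<forall>\<^sub>F t in at_right 0. dY y0 z - dY (y t) y0 \<le> dY (y t) z"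
      using ev
    proof eventually_elim
      case (elim t)
      have "dY y0 z \<le> dY y0 (y t) + dY (y t) z" "dY y0 (y t) = dY (y t) y0"
        using em yY[OF elim] zY y0 unfolding ext_metric_def by blast+
      thus ?case using fin by (auto simp: ennreal_minus_le_iff)
    qed
  qed
next
  case False
  have zY: "z \<in> Y" using z by (simp add: dom_E_def)
  have "dY z z = 0" using em zY by (simp add: ext_metric_def)
  hence "z \<in> dclosure Y dY (dom_E Y E)" using z zY by (auto simp: dclosure_def intro!: bexI[of _ z])
  thus ?thesis using flow False by (simp add: EVI_flow_def)
qed

text \<open>The distance to a fixed point is 1-Lipschitz, so it inherits the modulus of the
  curve.\<close>

lemma loc_abs_cont_dist_ac_on:
  assumes em: "ext_metric Y dY" and yY: "\<And>t. t > 0 \<Longrightarrow> y t \<in> Y" and zY: "z \<in> Y"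
    and lac: "loc_abs_cont dY y" and fin: "\<And>t. t > 0 \<Longrightarrow> dY (y t) z < \<infinity>"
    and ab: "0 < a" "a \<le> b"
  shows "ac_on a b (\<lambda>t. enn2real (dY (y t) z))"
proof -
  obtain g where g: "set_integrable lborel {a..b} g"
    "\<And>s t. a \<le> s \<Longrightarrow> s \<le> t \<Longrightarrow> t \<le> b \<Longrightarrow>
       dY (y s) (y t) \<le> ennreal (set_lebesgue_integral lborel {s..t} g)"
    using lac[unfolded loc_abs_cont_def, rule_format, OF conjI[OF ab]] by auto
  \<comment> \<open>The density \<open>g\<close> of the curve may take negative values, whereas
    \<open>ac_on\<close> asks for a nonnegative one, hence the absolute value.\<close>
  have "\<bar>enn2real (dY (y t) z) - enn2real (dY (y s) z)\<bar> \<le> set_lebesgue_integral lborel {s..t} (\<lambda>x. \<bar>g x\<bar>)"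
    if st: "a \<le> s" "s \<le> t" "t \<le> b" for s t
  proof -
    let ?I = "set_lebesgue_integral lborel {s..t} (\<lambda>x. \<bar>g x\<bar>)"
    have gi: "set_integrable lborel {s..t} g" using g(1) st by (auto intro: set_integrable_subset)
    have "set_lebesgue_integral lborel {s..t} g \<le> ?I"
      using gi set_integrable_abs[OF gi] by (intro set_integral_mono) auto
    hence le: "dY (y s) (y t) \<le> ennreal ?I" using g(2)[OF st] by (meson ennreal_leI order_trans)
    have I: "0 \<le> ?I" unfolding set_lebesgue_integral_def by (auto intro!: integral_nonneg_AE)
    have p: "0 < s" "0 < t" using st ab by auto
    have sym: "dY (y t) (y s) = dY (y s) (y t)"
      and t1: "dY (y s) z \<le> dY (y s) (y t) + dY (y t) z"
      and t2: "dY (y t) z \<le> dY (y t) (y s) + dY (y s) z"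
      using em yY[OF p(1)] yY[OF p(2)] zY unfolding ext_metric_def by blast+
    obtain u v where uv: "dY (y s) z = ennreal u" "dY (y t) z = ennreal v" "0 \<le> u" "0 \<le> v"
      using fin[OF p(1)] fin[OF p(2)] by (metis ennreal_cases less_irrefl infinity_ennreal_def)
    have "ennreal u \<le> ennreal (?I + v)" "ennreal v \<le> ennreal (?I + u)"
      using t1 t2 le I uv by (auto simp: sym ennreal_plus intro: order_trans add_right_mono)
    hence "u \<le> ?I + v" "v \<le> ?I + u" using uv I by (simp_all only: ennreal_le_iff add_nonneg_nonneg)
    thus ?thesis using uv by (simp add: abs_le_iff)
  qed
  thus ?thesis unfolding ac_on_def using set_integrable_abs[OF g(1)]
    by (intro exI[of _ "\<lambda>x. \<bar>g x\<bar>"]) auto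
qed

text \<open>Convergence at time 0 makes the distance finite at some early time, and absolute
  continuity keeps any two positive times at finite distance from each other.\<close>

lemma EVI_flow_dist_finite:
  assumes em: "ext_metric Y dY" and y0: "y0 \<in> Y" and flow: "EVI_flow Y dY E K y0 y"
    and z: "z \<in> dom_E Y E" and fin: "dY y0 z < \<infinity>" and t: "0 < t"
  shows "dY (y t) z < \<infinity>"
proof -
  have yY: "y t \<in> Y" if "t > 0" for t using flow that by (simp add: EVI_flow_def)
  have zY: "z \<in> Y" using z by (simp add: dom_E_def)
  have "\<forall>\<^sub>F s in at_right 0. dY (y s) z < \<infinity>"
    using order_tendstoD(2)[OF EVI_flow_dist_tendsto[OF assms(1-5)] fin] .
  moreover have "\<forall>\<^sub>F s in at_right 0. s \<in> {0<..<t}" using t by (rule eventually_at_right_real)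
  ultimately have "\<forall>\<^sub>F s in at_right 0. dY (y s) z < \<infinity> \<and> 0 < s \<and> s < t"
    by eventually_elim auto
  then obtain s where s: "dY (y s) z < \<infinity>" "0 < s" "s < t"
    using eventually_happens[of _ "at_right (0::real)"] by auto
  obtain g where "dY (y s) (y t) \<le> ennreal (set_lebesgue_integral lborel {s..t} g)"
    using flow s unfolding EVI_flow_def loc_abs_cont_def by (meson less_imp_le order_refl)
  hence "dY (y s) (y t) < \<infinity>" by (metis ennreal_less_top infinity_ennreal_def le_less_trans)
  moreover have "dY (y t) z \<le> dY (y t) (y s) + dY (y s) z" "dY (y t) (y s) = dY (y s) (y t)"
    using em yY[OF t] yY[OF s(2)] zY unfolding ext_metric_def by blast+
  ultimately show ?thesis using s(1) by (metis ennreal_add_less_top infinity_ennreal_def le_less_trans)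
qed

text \<open>A Gronwall argument: the factor \<open>exp (K * t)\<close> absorbs the term with
  \<open>K\<close>, and what remains is the derivative of a nonincreasing function.\<close>

lemma EVI_flow_integrated:
  assumes em: "ext_metric Y dY" and y0: "y0 \<in> Y" and flow: "EVI_flow Y dY E K y0 y"
    and lower: "\<And>t. 0 < t \<Longrightarrow> t < \<delta> \<Longrightarrow> ereal c \<le> E (y t)"
    and z: "z \<in> dom_E Y E" "E z = ereal e" and fin: "dY y0 z < \<infinity>" and t: "0 < t" "t < \<delta>"
  shows "exp (K * t) * (enn2real (dY (y t) z))\<^sup>2 / 2 + c * exp_primitive K t
    \<le> (enn2real (dY y0 z))\<^sup>2 / 2 + e * exp_primitive K t"
proof -
  define u where "u = (\<lambda>t. enn2real (dY (y t) z))"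
  \<comment> \<open>Its derivative is \<open>exp (K * r)\<close> times the left side of the
    variational inequality plus \<open>c - e\<close>, hence nonpositive almost everywhere as long as
    \<open>c\<close> bounds the energy from below.\<close>
  define F where "F = (\<lambda>t. exp (K * t) * ((u t)\<^sup>2 / 2) + (c - e) * exp_primitive K t)"
  have yY: "y t \<in> Y" if "t > 0" for t using flow that by (simp add: EVI_flow_def)
  have zY: "z \<in> Y" using z by (simp add: dom_E_def)
  have fin_t: "dY (y t) z < \<infinity>" if "t > 0" for t
    using EVI_flow_dist_finite[OF em y0 flow z(1) fin that] .
  have lac: "loc_abs_cont dY y" using flow by (simp add: EVI_flow_def)
  have sym: "dY z (y t) = dY (y t) z" if "t > 0" for t
    using em yY[OF that] zY by (simp add: ext_metric_def)
  have ae: "AE t in lborel. t > 0 \<longrightarrow> (\<exists>D. ((\<lambda>s. (u s)\<^sup>2) has_real_derivative D) (at t) \<and>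
      ereal (D / 2 + K / 2 * (u t)\<^sup>2) \<le> E z - E (y t))"
  proof -
    have "\<exists>t>0. dY z (y t) < \<infinity>" using sym[OF t(1)] fin_t[OF t(1)] t(1) by auto
    thus ?thesis using flow z(1) unfolding EVI_flow_def u_def by blast
  qed
  have le: "F t \<le> F s" if s: "0 < s" "s \<le> t" for s
  proof (rule ac_on_nonincreasing[OF s(2)])
    have u: "ac_on s t u" unfolding u_def
      by (rule loc_abs_cont_dist_ac_on[OF em yY zY lac fin_t s])
    have h: "ac_on s t (\<lambda>_. 1/2)" by (rule ac_on_lipschitz[where L = 0]) simp
    have c: "ac_on s t (\<lambda>_. c - e)" by (rule ac_on_lipschitz[where L = 0]) simp
    have p: "ac_on s t (exp_primitive K)"
      by (rule ac_on_C1[where F' = "\<lambda>t. exp (K * t)"]) (auto intro!: exp_primitive_deriv continuous_intros)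
    have x: "ac_on s t (\<lambda>t. exp (K * t))"
      by (rule ac_on_C1[where F' = "\<lambda>t. exp (K * t) * K"]) (auto intro!: derivative_eq_intros continuous_intros)
    show "ac_on s t F"
      using ac_on_add[OF ac_on_mult[OF x ac_on_mult[OF ac_on_mult[OF u u] h]] ac_on_mult[OF c p]]
      by (simp add: F_def power2_eq_square)
    show "AE r in lborel. s \<le> r \<longrightarrow> r \<le> t \<longrightarrow> (\<exists>D\<le>0. (F has_real_derivative D) (at r))"
      using ae
    proof eventually_elim
      case (elim r)
      show ?case
      proof (intro impI)
        assume r: "s \<le> r" "r \<le> t"
        obtain D where D: "((\<lambda>s. (u s)\<^sup>2) has_real_derivative D) (at r)"
          "ereal (D / 2 + K / 2 * (u r)\<^sup>2) \<le> E z - E (y r)" using elim r s by auto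
        have "E z - E (y r) \<le> E z - ereal c" using lower[of r] r s t by (intro ereal_minus_mono) auto
        hence "D / 2 + K / 2 * (u r)\<^sup>2 \<le> e - c" using D(2) z(2)
          by (metis ereal_minus(1) ereal_less_eq(3) order_trans)
        moreover have "(F has_real_derivative exp (K * r) * (D / 2 + K / 2 * (u r)\<^sup>2 + (c - e))) (at r)"
          unfolding F_def
          by (rule derivative_eq_intros refl D(1) exp_primitive_deriv | simp add: algebra_simps)+
        ultimately show "\<exists>D\<le>0. (F has_real_derivative D) (at r)"
          by (intro exI[of _ "exp (K * r) * (D / 2 + K / 2 * (u r)\<^sup>2 + (c - e))"])
             (auto intro!: mult_nonneg_nonpos)
      qed
    qed
  qed
  have "((\<lambda>s. dY (y s) z) \<longlongrightarrow> dY y0 z) (at_right 0)"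
    by (rule EVI_flow_dist_tendsto[OF em y0 flow z(1) fin])
  hence "(u \<longlongrightarrow> enn2real (dY y0 z)) (at_right 0)" unfolding u_def
    using fin by (intro tendsto_enn2real) auto
  moreover have "((\<lambda>s. exp (K * s)) \<longlongrightarrow> exp (K * 0)) (at_right 0)"
    by (intro tendsto_intros)
  ultimately have "(F \<longlongrightarrow> exp (K * 0) * ((enn2real (dY y0 z))\<^sup>2 / 2) + (c - e) * 0) (at_right 0)"
    unfolding F_def by (intro tendsto_intros exp_primitive_tendsto_0) auto
  moreover have "\<forall>\<^sub>F s in at_right 0. F t \<le> F s"
    using eventually_at_right_real[OF t(1)] by eventually_elim (auto intro: le)
  ultimately have "F t \<le> exp (K * 0) * ((enn2real (dY y0 z))\<^sup>2 / 2) + (c - e) * 0"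
    by (intro tendsto_lowerbound) auto
  thus ?thesis by (simp add: F_def u_def algebra_simps)
qed

section \<open>Duality for the entropy\<close>

text \<open>Young's inequality: \<open>exp (p - 1)\<close> is the convex conjugate of
  \<open>r * ln r\<close>. It comes from ln x \<le> x - 1 at x = exp (p - 1) / r, and for
  \<open>r = 0\<close> from the convention 0 ln 0 = 0.\<close>

lemma mult_ln_ge_Legendre:
  fixes r p :: real
  assumes "0 \<le> r"
  shows "r * p - exp (p - 1) \<le> r * ln r"
proof (cases "r = 0")
  case False
  with assms have r: "0 < r" by simp
  have "ln (exp (p - 1) / r) \<le> exp (p - 1) / r - 1" using r by (intro ln_le_minus_one) auto
  hence "p - ln r \<le> exp (p - 1) / r" using r by (simp add: ln_div)
  hence "r * (p - ln r) \<le> r * (exp (p - 1) / r)" using r by (intro mult_left_mono) auto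
  thus ?thesis using r by (simp add: algebra_simps)
qed simp

text \<open>The negative part of \<open>r * ln r\<close> is bounded and \<open>m\<close> has mass 1,
  so a finite entropy forces the positive part to be integrable too. The difference in
  \<open>ereal\<close> thereby becomes an ordinary integral.\<close>

lemma Ent_finite_density:
  assumes m: "prob_space m" and \<nu>: "prob_space \<nu>" and fin: "Ent m \<nu> < \<infinity>"
  obtains \<rho> where "\<rho> \<in> borel_measurable m" "\<And>x. 0 \<le> \<rho> x" "\<nu> = density m (\<lambda>x. ennreal (\<rho> x))"
    "integrable m \<rho>" "integrable m (\<lambda>x. \<rho> x * ln (\<rho> x))"
    "Ent m \<nu> = ereal (\<integral>x. \<rho> x * ln (\<rho> x) \<partial>m)"
proof -
  interpret m: prob_space m by fact
  interpret \<nu>: prob_space \<nu> by fact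
  define \<rho> where "\<rho> = (\<lambda>x. enn2real (RN_deriv m \<nu> x))"
  have s: "sets \<nu> = sets m" and ac: "absolutely_continuous m \<nu>"
    using fin by (auto simp: Ent_def split: if_splits)
  have Ent_eq: "Ent m \<nu> = ereal_integral m (\<lambda>x. ereal (\<rho> x * ln (\<rho> x)))"
    using s ac by (simp add: Ent_def \<rho>_def Let_def)
  have [measurable]: "\<rho> \<in> borel_measurable m" by (simp add: \<rho>_def)
  have pos: "0 \<le> \<rho> x" for x by (simp add: \<rho>_def)
  have "AE x in m. RN_deriv m \<nu> x \<noteq> \<infinity>"
    using m.RN_deriv_finite[OF \<nu>.sigma_finite_measure_axioms ac s] .
  hence "AE x in m. ennreal (\<rho> x) = RN_deriv m \<nu> x"
    by eventually_elim (simp add: \<rho>_def less_top)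
  hence "density m (\<lambda>x. ennreal (\<rho> x)) = density m (RN_deriv m \<nu>)"
    by (intro density_cong) auto
  hence dens: "\<nu> = density m (\<lambda>x. ennreal (\<rho> x))"
    using m.density_RN_deriv[OF ac s] by simp
  have "(\<integral>\<^sup>+x. ennreal (\<rho> x) \<partial>m) = emeasure \<nu> (space \<nu>)"
    by (subst (1) dens) (simp add: emeasure_density sets_eq_imp_space_eq[OF s])
  hence "(\<integral>\<^sup>+x. ennreal (\<rho> x) \<partial>m) = 1" by (simp add: \<nu>.emeasure_space_1)
  hence int: "integrable m \<rho>" using pos by (intro integrableI_nonneg) auto
  have neg: "(\<integral>\<^sup>+x. ennreal (- (\<rho> x * ln (\<rho> x))) \<partial>m) \<le> 1"
  proof -
    have "- (\<rho> x * ln (\<rho> x)) \<le> 1" for x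
    proof -
      \<comment> \<open>The choice p = 0 in Young's inequality bounds r ln r from below by -exp
        (-1).\<close>
      have "exp (0 - 1) \<le> (1::real)" by simp
      thus ?thesis using mult_ln_ge_Legendre[OF pos, of x 0] by linarith
    qed
    hence "(\<integral>\<^sup>+x. ennreal (- (\<rho> x * ln (\<rho> x))) \<partial>m) \<le> (\<integral>\<^sup>+x. 1 \<partial>m)"
      by (intro nn_integral_mono) (metis ennreal_1 ennreal_leI)
    thus ?thesis by (simp add: m.emeasure_space_1)
  qed
  hence neg': "(\<integral>\<^sup>+x. ennreal (- (\<rho> x * ln (\<rho> x))) \<partial>m) < \<top>"
    by (meson ennreal_one_less_top le_less_trans)
  have E: "Ent m \<nu> = enn2ereal (\<integral>\<^sup>+x. ennreal (\<rho> x * ln (\<rho> x)) \<partial>m)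
      - enn2ereal (\<integral>\<^sup>+x. ennreal (- (\<rho> x * ln (\<rho> x))) \<partial>m)"
    by (simp add: Ent_eq ereal_integral_def)
  obtain b where b: "0 \<le> b" "(\<integral>\<^sup>+x. ennreal (- (\<rho> x * ln (\<rho> x))) \<partial>m) = ennreal b"
    using neg' by (metis ennreal_cases less_irrefl)
  have "(\<integral>\<^sup>+x. ennreal (\<rho> x * ln (\<rho> x)) \<partial>m) \<noteq> \<top>"
  proof
    assume "(\<integral>\<^sup>+x. ennreal (\<rho> x * ln (\<rho> x)) \<partial>m) = \<top>"
    with E fin b show False by (simp add: top_ennreal.rep_eq)
  qed
  then obtain a where a: "0 \<le> a" "(\<integral>\<^sup>+x. ennreal (\<rho> x * ln (\<rho> x)) \<partial>m) = ennreal a"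
    by (metis ennreal_cases)
  have i: "integrable m (\<lambda>x. \<rho> x * ln (\<rho> x))"
    unfolding real_integrable_def using a b by auto
  have "Ent m \<nu> = ereal (\<integral>x. \<rho> x * ln (\<rho> x) \<partial>m)"
    using E a b by (simp add: real_lebesgue_integral_def[OF i] enn2ereal_ennreal)
  thus ?thesis using that[of \<rho>] pos dens int i by simp
qed

text \<open>One half of the Donsker--Varadhan duality. Taking the Legendre transform of \<open>r ln r\<close> pointwise
  gives a functional that is affine in \<open>\<nu>\<close>.\<close>

lemma Ent_ge_dual:
  assumes m: "prob_space m" and \<nu>: "prob_space \<nu>"
    and \<phi>[measurable]: "\<phi> \<in> borel_measurable m" and bd: "\<And>x. x \<in> space m \<Longrightarrow> \<bar>\<phi> x\<bar> \<le> B"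
  shows "ereal ((\<integral>x. \<phi> x \<partial>\<nu>) - (\<integral>x. exp (\<phi> x - 1) \<partial>m)) \<le> Ent m \<nu>"
proof (cases "Ent m \<nu> < \<infinity>")
  case True
  interpret m: prob_space m by fact
  obtain \<rho> where \<rho>[measurable]: "\<rho> \<in> borel_measurable m" and pos: "\<And>x. 0 \<le> \<rho> x"
    and dens: "\<nu> = density m (\<lambda>x. ennreal (\<rho> x))"
    and i: "integrable m \<rho>" "integrable m (\<lambda>x. \<rho> x * ln (\<rho> x))"
    and E: "Ent m \<nu> = ereal (\<integral>x. \<rho> x * ln (\<rho> x) \<partial>m)"
    using Ent_finite_density[OF m \<nu> True] by blast
  have "\<bar>exp (\<phi> x - 1)\<bar> \<le> exp (B - 1)" if "x \<in> space m" for x using bd[OF that] by simp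
  hence ie: "integrable m (\<lambda>x. exp (\<phi> x - 1))"
    by (intro m.integrable_const_bound[of _ "exp (B - 1)"]) auto
  have ip: "integrable m (\<lambda>x. \<rho> x * \<phi> x)"
  proof (rule Bochner_Integration.integrable_bound)
    show "integrable m (\<lambda>x. B * \<rho> x)" using i(1) by simp
    show "AE x in m. norm (\<rho> x * \<phi> x) \<le> norm (B * \<rho> x)"
    proof (rule AE_I2)
      fix x assume "x \<in> space m"
      hence "\<rho> x * \<bar>\<phi> x\<bar> \<le> \<rho> x * \<bar>B\<bar>" using bd[of x] pos[of x] by (intro mult_left_mono) auto
      thus "norm (\<rho> x * \<phi> x) \<le> norm (B * \<rho> x)" using pos[of x] by (simp add: abs_mult mult.commute)
    qed
  qed simp
  have "(\<integral>x. \<phi> x \<partial>\<nu>) - (\<integral>x. exp (\<phi> x - 1) \<partial>m) = (\<integral>x. \<rho> x * \<phi> x - exp (\<phi> x - 1) \<partial>m)"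
    unfolding dens using ie ip pos by (subst integral_density) auto
  also have "\<dots> \<le> (\<integral>x. \<rho> x * ln (\<rho> x) \<partial>m)"
    using ie ip i pos by (intro integral_mono mult_ln_ge_Legendre) auto
  finally show ?thesis by (simp add: E)
qed auto

text \<open>The constant test function 1 has dual value 1 - exp 0 = 0.\<close>

lemma Ent_nonneg:
  assumes "prob_space m" "prob_space \<nu>"
  shows "0 \<le> Ent m \<nu>"
  using Ent_ge_dual[OF assms, of "\<lambda>_. 1" 1] prob_space.prob_space[OF assms(1)] prob_space.prob_space[OF assms(2)]
  by (simp add: zero_ereal_def)

text \<open>The other half of the duality. Equality in Young's inequality holds for \<phi> = 1 + ln
  \<rho>, which may be unbounded; truncating the density gives bounded test functions whose dual
  values converge to the entropy.\<close>

lemma Ent_less_dual: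
  assumes m: "prob_space m" and \<nu>: "prob_space \<nu>" and fin: "Ent m \<nu> < \<infinity>" and c: "ereal c < Ent m \<nu>"
  obtains \<phi> B where "\<phi> \<in> borel_measurable m" "\<And>x. \<bar>\<phi> x\<bar> \<le> B"
    "c < (\<integral>x. \<phi> x \<partial>\<nu>) - (\<integral>x. exp (\<phi> x - 1) \<partial>m)"
proof -
  interpret m: prob_space m by fact
  obtain \<rho> where \<rho>[measurable]: "\<rho> \<in> borel_measurable m" and pos: "\<And>x. 0 \<le> \<rho> x"
    and dens: "\<nu> = density m (\<lambda>x. ennreal (\<rho> x))"
    and i: "integrable m \<rho>" "integrable m (\<lambda>x. \<rho> x * ln (\<rho> x))"
    and E: "Ent m \<nu> = ereal (\<integral>x. \<rho> x * ln (\<rho> x) \<partial>m)"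
    using Ent_finite_density[OF m \<nu> fin] by blast
  define k where "k = (\<lambda>n::nat. 1 + real n)"
  \<comment> \<open>The density is clipped away from 0 as well as from infinity, since the logarithm
    is unbounded at both ends.\<close>
  define cl where "cl = (\<lambda>n x. max (1 / k n) (min (k n) (\<rho> x)))"
  define \<phi> where "\<phi> = (\<lambda>n x. 1 + ln (cl n x))"
  have k1: "1 \<le> k n" for n by (simp add: k_def)
  have [measurable]: "cl n \<in> borel_measurable m" "\<phi> n \<in> borel_measurable m" for n
    by (simp_all add: cl_def \<phi>_def)
  have cl: "1 / k n \<le> cl n x" "cl n x \<le> k n" for n x
    using k1[of n] by (auto simp: cl_def divide_le_eq mult_ge1_I intro: order_trans)
  have cl_pos: "0 < cl n x" for n x using cl(1)[of n x] k1[of n] by (smt (verit) zero_less_divide_1_iff)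
  have \<phi>_bd: "\<bar>\<phi> n x\<bar> \<le> 1 + ln (k n)" for n x
  proof -
    have "ln (cl n x) \<le> ln (k n)" using cl cl_pos by (simp add: ln_mono)
    moreover have "ln (1 / k n) \<le> ln (cl n x)" using cl cl_pos k1[of n] by (intro ln_mono) auto
    moreover have "ln (1 / k n) = - ln (k n)" using k1[of n] by (simp add: ln_div)
    ultimately show ?thesis by (simp add: \<phi>_def)
  qed
  have exp_\<phi>: "exp (\<phi> n x - 1) = cl n x" for n x using cl_pos by (simp add: \<phi>_def)
  define q where "q = (\<lambda>n x. \<rho> x * \<phi> n x - cl n x)"
  have q_le: "q n x \<le> \<rho> x * ln (\<rho> x)" for n x
    using mult_ln_ge_Legendre[OF pos, of x "\<phi> n x"] by (simp add: q_def exp_\<phi>)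
  have q_eq: "q n x = \<rho> x * ln (\<rho> x)" if "1 / k n \<le> \<rho> x" "\<rho> x \<le> k n" for n x
    using that by (simp add: q_def \<phi>_def cl_def algebra_simps)
  \<comment> \<open>Lower envelope for dominated convergence. Below the range \<open>q\<close> loses
    at most \<rho> ln k \<le> ln k / k \<le> 1 and 1 / k \<le> 1, which explains the -2; above the
    range \<open>q\<close> is nonnegative.\<close>
  have q_ge: "min (\<rho> x * ln (\<rho> x)) (-2) \<le> q n x" for n x
  proof -
    consider "\<rho> x < 1 / k n" | "k n < \<rho> x" | "1 / k n \<le> \<rho> x" "\<rho> x \<le> k n" by linarith
    thus ?thesis
    proof cases
      case 1
      have kk: "1 / k n \<le> k n" using cl order_trans by blast
      hence c1: "cl n x = 1 / k n" using 1 by (simp add: cl_def)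
      have ln: "0 \<le> ln (k n)" "ln (k n) \<le> k n" using k1[of n] ln_le_minus_one[of "k n"] by auto
      have "\<rho> x * ln (k n) \<le> (1 / k n) * k n" using 1 ln k1[of n] pos by (intro mult_mono) auto
      hence "\<rho> x * ln (k n) \<le> 1" using k1[of n] by simp
      moreover have "1 / k n \<le> 1" using k1[of n] by simp
      moreover have "q n x = \<rho> x - \<rho> x * ln (k n) - 1 / k n"
        using k1[of n] by (simp add: q_def \<phi>_def c1 ln_div algebra_simps)
      ultimately show ?thesis using pos[of x] by linarith
    next
      case 2
      have "1 / k n \<le> k n" using cl order_trans by blast
      hence "cl n x = k n" using 2 by (simp add: cl_def)
      moreover have "0 \<le> \<rho> x * ln (k n)" using pos k1[of n] by simp
      ultimately show ?thesis using 2 by (simp add: q_def \<phi>_def distrib_left)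
    next
      case 3
      thus ?thesis using q_eq by simp
    qed
  qed
  have lim: "(\<lambda>n. q n x) \<longlonglongrightarrow> \<rho> x * ln (\<rho> x)" for x
  proof (cases "\<rho> x = 0")
    case True
    have "cl n x = 1 / k n" for n using True k1[of n] by (auto simp: cl_def)
    hence "q n x = - (1 / k n)" for n using True by (simp add: q_def)
    moreover have "(\<lambda>n. - (1 / k n)) \<longlonglongrightarrow> - 0" unfolding k_def
      using LIMSEQ_inverse_real_of_nat by (intro tendsto_minus) (simp add: inverse_eq_divide add.commute)
    ultimately show ?thesis using True by simp
  next
    case False
    hence p: "0 < \<rho> x" using pos[of x] by simp
    obtain N where N: "max (\<rho> x) (1 / \<rho> x) \<le> real N" using real_arch_simple by blast
    have "\<forall>\<^sub>F n in sequentially. q n x = \<rho> x * ln (\<rho> x)"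
      using eventually_ge_at_top[of N]
    proof eventually_elim
      case (elim n)
      have "\<rho> x \<le> k n" "1 / \<rho> x \<le> k n" using N elim by (auto simp: k_def)
      thus ?case using p k1[of n] by (intro q_eq) (auto simp: field_simps)
    qed
    thus ?thesis by (rule tendsto_eventually)
  qed
  have "(\<lambda>n. \<integral>x. q n x \<partial>m) \<longlonglongrightarrow> (\<integral>x. \<rho> x * ln (\<rho> x) \<partial>m)"
  proof (rule integral_dominated_convergence)
    show "integrable m (\<lambda>x. \<bar>\<rho> x * ln (\<rho> x)\<bar> + 2)" using i(2) by simp
    show "AE x in m. norm (q n x) \<le> \<bar>\<rho> x * ln (\<rho> x)\<bar> + 2" for n
    proof (rule AE_I2)
      fix x show "norm (q n x) \<le> \<bar>\<rho> x * ln (\<rho> x)\<bar> + 2" using q_le[of n x] q_ge[of x n] by auto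
    qed
  qed (use lim in \<open>auto simp: q_def\<close>)
  moreover have "c < (\<integral>x. \<rho> x * ln (\<rho> x) \<partial>m)" using c E by simp
  ultimately have "\<forall>\<^sub>F n in sequentially. c < (\<integral>x. q n x \<partial>m)" by (rule order_tendstoD(1))
  then obtain n where n: "c < (\<integral>x. q n x \<partial>m)" using eventually_happens by force
  have "integrable m (\<lambda>x. \<rho> x * \<phi> n x)"
  proof (rule Bochner_Integration.integrable_bound)
    show "integrable m (\<lambda>x. (1 + ln (k n)) * \<rho> x)" using i(1) by simp
    show "AE x in m. norm (\<rho> x * \<phi> n x) \<le> norm ((1 + ln (k n)) * \<rho> x)"
    proof (rule AE_I2)
      fix x show "norm (\<rho> x * \<phi> n x) \<le> norm ((1 + ln (k n)) * \<rho> x)"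
        using pos[of x] \<phi>_bd[of n x] k1[of n] by (simp add: abs_mult mult.commute mult_left_mono)
    qed
  qed simp
  moreover have "integrable m (cl n)"
    using cl cl_pos by (intro m.integrable_const_bound[of _ "k n"]) (auto simp: less_imp_le)
  ultimately have "(\<integral>x. q n x \<partial>m) = (\<integral>x. \<phi> n x \<partial>\<nu>) - (\<integral>x. exp (\<phi> n x - 1) \<partial>m)"
    unfolding dens q_def exp_\<phi> using pos by (subst integral_density) auto
  with n show ?thesis using that[of "\<phi> n" "1 + ln (k n)"] \<phi>_bd by simp
qed

section \<open>Bounded Lipschitz functions on extended metric-topological spaces\<close>

lemma sets_borel_of: "sets (borel_of T) = sigma_sets (topspace T) {U. openin T U}"
  unfolding borel_of_def by (rule sets_measure_of) (auto dest: openin_subset)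

lemma space_borel_of: "space (borel_of T) = topspace T"
  unfolding borel_of_def by (rule space_measure_of) (auto dest: openin_subset)

lemma openin_sets_borel_of: "openin T U \<Longrightarrow> U \<in> sets (borel_of T)"
  by (simp add: sets_borel_of sigma_sets.Basic)

lemma closedin_sets_borel_of:
  assumes "closedin T C"
  shows "C \<in> sets (borel_of T)"
proof -
  have "space (borel_of T) - (topspace T - C) \<in> sets (borel_of T)"
    using assms by (intro sets.compl_sets openin_sets_borel_of) (simp add: closedin_def)
  moreover have "space (borel_of T) - (topspace T - C) = C"
    using assms by (auto simp: space_borel_of closedin_def)
  ultimately show ?thesis by simp
qed

lemma continuous_map_borel_of_measurable:
  assumes "continuous_map T S f"
  shows "f \<in> measurable (borel_of T) (borel_of S)"
  unfolding borel_of_def[of S]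
proof (rule measurable_measure_of)
  show "f \<in> space (borel_of T) \<rightarrow> topspace S"
    using assms by (auto simp: space_borel_of continuous_map_def)
  fix U assume "U \<in> {U. openin S U}"
  hence "openin T {x \<in> topspace T. f x \<in> U}" using assms by (simp add: continuous_map_def)
  moreover have "f -` U \<inter> space (borel_of T) = {x \<in> topspace T. f x \<in> U}" by (auto simp: space_borel_of)
  ultimately show "f -` U \<inter> space (borel_of T) \<in> sets (borel_of T)" by (simp add: openin_sets_borel_of)
qed (auto dest: openin_subset)

lemma continuous_map_real_borel_measurable:
  assumes "continuous_map T euclideanreal f" "sets M = sets (borel_of T)"
  shows "f \<in> borel_measurable M"
proof (rule borel_measurableI)
  fix U :: "real set" assume "open U"
  hence "openin T {x \<in> topspace T. f x \<in> U}" using assms by (simp add: continuous_map_def)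
  moreover have "f -` U \<inter> space M = {x \<in> topspace T. f x \<in> U}"
    using sets_eq_imp_space_eq[OF assms(2)] by (auto simp: space_borel_of)
  ultimately show "f -` U \<inter> space M \<in> sets M" by (simp add: openin_sets_borel_of assms(2))
qed

text \<open>One closure property that covers minima, maxima and sums: Lipschitz operations on two
  functions preserve continuity, boundedness and the Lipschitz bound.\<close>

lemma Lip_b_combine:
  fixes \<Phi> :: "real \<Rightarrow> real \<Rightarrow> real"
  assumes f: "f \<in> Lip_b T d" and g: "g \<in> Lip_b T d"
    and \<Phi>: "\<And>a b a' b'. \<bar>\<Phi> a b - \<Phi> a' b'\<bar> \<le> C * (\<bar>a - a'\<bar> + \<bar>b - b'\<bar>)"
  shows "(\<lambda>x. \<Phi> (f x) (g x)) \<in> Lip_b T d"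
proof -
  obtain L1 where L1: "continuous_map T euclideanreal f" "bounded (f ` topspace T)"
    "\<And>x y. x \<in> topspace T \<Longrightarrow> y \<in> topspace T \<Longrightarrow> ennreal \<bar>f x - f y\<bar> \<le> ennreal L1 * d x y"
    using f by (auto simp: Lip_b_def lip_b_def)
  obtain L2 where L2: "continuous_map T euclideanreal g" "bounded (g ` topspace T)"
    "\<And>x y. x \<in> topspace T \<Longrightarrow> y \<in> topspace T \<Longrightarrow> ennreal \<bar>g x - g y\<bar> \<le> ennreal L2 * d x y"
    using g by (auto simp: Lip_b_def lip_b_def)
  have C: "0 \<le> C" using order_trans[OF abs_ge_zero \<Phi>[of 1 0 0 0]] by simp
  have "(2 * C)-lipschitz_on UNIV (\<lambda>p. \<Phi> (fst p) (snd p))"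
  proof (rule lipschitz_onI)
    fix p q :: "real \<times> real"
    have "\<bar>fst p - fst q\<bar> \<le> dist p q" "\<bar>snd p - snd q\<bar> \<le> dist p q"
      using dist_fst_le[of p q] dist_snd_le[of p q] by (auto simp: dist_real_def)
    hence "C * (\<bar>fst p - fst q\<bar> + \<bar>snd p - snd q\<bar>) \<le> C * (2 * dist p q)"
      using C by (intro mult_left_mono) auto
    thus "dist (\<Phi> (fst p) (snd p)) (\<Phi> (fst q) (snd q)) \<le> 2 * C * dist p q"
      using \<Phi>[of "fst p" "snd p" "fst q" "snd q"] by (simp add: dist_real_def mult.assoc mult.left_commute)
  qed (use C in simp)
  hence "continuous_on UNIV (\<lambda>p. \<Phi> (fst p) (snd p))" by (rule lipschitz_on_continuous_on)
  hence "continuous_map (prod_topology euclideanreal euclideanreal) euclideanreal (\<lambda>p. \<Phi> (fst p) (snd p))"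
    by (simp add: continuous_map_iff_continuous2)
  from continuous_map_compose[OF continuous_map_pairedI[OF L1(1) L2(1)] this]
  have cont: "continuous_map T euclideanreal (\<lambda>x. \<Phi> (f x) (g x))" by (simp add: o_def)
  obtain B1 where B1: "\<And>x. x \<in> topspace T \<Longrightarrow> \<bar>f x\<bar> \<le> B1"
    using L1(2) by (auto simp: bounded_iff)
  obtain B2 where B2: "\<And>x. x \<in> topspace T \<Longrightarrow> \<bar>g x\<bar> \<le> B2"
    using L2(2) by (auto simp: bounded_iff)
  have "\<bar>\<Phi> (f x) (g x)\<bar> \<le> \<bar>\<Phi> 0 0\<bar> + C * (B1 + B2)" if "x \<in> topspace T" for x
  proof -
    have "C * (\<bar>f x - 0\<bar> + \<bar>g x - 0\<bar>) \<le> C * (B1 + B2)"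
      using C B1[OF that] B2[OF that] by (intro mult_left_mono) auto
    thus ?thesis using \<Phi>[of "f x" "g x" 0 0] by linarith
  qed
  hence bdd: "bounded ((\<lambda>x. \<Phi> (f x) (g x)) ` topspace T)"
    by (auto simp: bounded_iff)
  \<comment> \<open>\<open>Lip_b\<close> admits negative constants, which \<open>ennreal\<close>
    sends to 0; absolute values make the constants additive.\<close>
  have "ennreal \<bar>\<Phi> (f x) (g x) - \<Phi> (f y) (g y)\<bar> \<le> ennreal (C * (\<bar>L1\<bar> + \<bar>L2\<bar>)) * d x y"
    if xy: "x \<in> topspace T" "y \<in> topspace T" for x y
  proof -
    have "ennreal \<bar>\<Phi> (f x) (g x) - \<Phi> (f y) (g y)\<bar> \<le> ennreal (C * (\<bar>f x - f y\<bar> + \<bar>g x - g y\<bar>))"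
      by (intro ennreal_leI \<Phi>)
    also have "\<dots> = ennreal C * (ennreal \<bar>f x - f y\<bar> + ennreal \<bar>g x - g y\<bar>)"
      using C by (simp add: ennreal_mult)
    also have "\<dots> \<le> ennreal C * (ennreal L1 * d x y + ennreal L2 * d x y)"
      using L1(3)[OF xy] L2(3)[OF xy] by (intro mult_left_mono add_mono) auto
    also have "\<dots> \<le> ennreal C * (ennreal \<bar>L1\<bar> * d x y + ennreal \<bar>L2\<bar> * d x y)"
      by (intro mult_left_mono add_mono mult_right_mono ennreal_leI) auto
    also have "\<dots> = ennreal (C * (\<bar>L1\<bar> + \<bar>L2\<bar>)) * d x y"
      using C by (simp add: ennreal_mult distrib_right mult.assoc)
    finally show ?thesis .
  qed
  with cont bdd have "(\<lambda>x. \<Phi> (f x) (g x)) \<in> lip_b T d (C * (\<bar>L1\<bar> + \<bar>L2\<bar>))"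
    by (simp add: lip_b_def)
  thus ?thesis unfolding Lip_b_def by blast
qed

lemma Lip_b_compose:
  fixes \<Phi> :: "real \<Rightarrow> real"
  assumes f: "f \<in> Lip_b T d" and \<Phi>: "\<And>a a'. \<bar>\<Phi> a - \<Phi> a'\<bar> \<le> C * \<bar>a - a'\<bar>"
  shows "(\<lambda>x. \<Phi> (f x)) \<in> Lip_b T d"
proof -
  have C: "0 \<le> C" using order_trans[OF abs_ge_zero \<Phi>[of 1 0]] by simp
  show ?thesis
  proof (rule Lip_b_combine[OF f f, where \<Phi> = "\<lambda>a b. \<Phi> a"])
    fix a b a' b' :: real
    show "\<bar>\<Phi> a - \<Phi> a'\<bar> \<le> C * (\<bar>a - a'\<bar> + \<bar>b - b'\<bar>)"
      using order_trans[OF \<Phi>[of a a'] mult_left_mono[OF _ C]] by simp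
  qed
qed

lemma Lip_b_const: "(\<lambda>_. c) \<in> Lip_b T d"
proof -
  have "bounded ((\<lambda>_. c) ` topspace T)" by (rule bounded_subset[of "{c}"]) auto
  thus ?thesis unfolding Lip_b_def lip_b_def by (auto intro!: exI[of _ 0])
qed

text \<open>Complete regularity with Lipschitz functions. The topology is generated by preimages
  under \<open>Lip_b\<close>, so induction over its generation applies: a tent function on a
  preimage, a minimum on an intersection, and the bump of one member on a union.\<close>

lemma Lip_b_bump:
  assumes emt: "emt_space T d" and U: "openin T U" and x: "x \<in> U"
  shows "\<exists>g\<in>Lip_b T d. g x = 1 \<and> (\<forall>y. 0 \<le> g y \<and> g y \<le> 1) \<and> (\<forall>y\<in>topspace T - U. g y = 0)"
proof -
  let ?B = "{{x \<in> topspace T. f x \<in> U} | f U. f \<in> Lip_b T d \<and> open U}"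
  have "T = topology_generated_by ?B" using emt by (simp add: emt_space_def)
  hence "openin (topology_generated_by ?B) U" using U by simp
  hence "generate_topology_on ?B U" by (rule openin_topology_generated_by)
  thus ?thesis using x
  proof (induction)
    case Empty
    then show ?case by simp
  next
    case (Int a b)
    obtain f where f: "f \<in> Lip_b T d" "f x = 1" "\<And>y. 0 \<le> f y \<and> f y \<le> 1" "\<forall>y\<in>topspace T - a. f y = 0"
      using Int.IH(1)[OF IntD1[OF Int.prems]] by blast
    obtain g where g: "g \<in> Lip_b T d" "g x = 1" "\<And>y. 0 \<le> g y \<and> g y \<le> 1" "\<forall>y\<in>topspace T - b. g y = 0"
      using Int.IH(2)[OF IntD2[OF Int.prems]] by blast
    have "(\<lambda>y. min (f y) (g y)) \<in> Lip_b T d"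
      by (rule Lip_b_combine[OF f(1) g(1), where C = 1]) (auto simp: min_def)
    moreover have "min (f y) (g y) = 0" if "y \<in> topspace T - a \<inter> b" for y
      using that f(3)[of y] f(4) g(3)[of y] g(4) by (cases "y \<in> a") auto
    moreover have "0 \<le> min (f y) (g y) \<and> min (f y) (g y) \<le> 1" for y using f(3)[of y] g(3)[of y] by auto
    ultimately show ?case using f(2) g(2)
      by (intro bexI[of _ "\<lambda>y. min (f y) (g y)"] conjI ballI allI) simp_all
  next
    case (UN K)
    then obtain k where k: "k \<in> K" "x \<in> k" by blast
    from UN.IH[OF this] k show ?case by blast
  next
    case (Basis s)
    then obtain f V where s: "s = {x \<in> topspace T. f x \<in> V}" "f \<in> Lip_b T d" "open V" by blast
    obtain r where r: "0 < r" "ball (f x) r \<subseteq> V"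
      using Basis.prems s open_contains_ball by blast
    \<comment> \<open>A tent of height 1 around the value \<open>f x\<close>, of radius
      \<open>r\<close> so that it vanishes outside the ball contained in \<open>V\<close>.\<close>
    define g where "g = (\<lambda>y. max 0 (1 - \<bar>f y - f x\<bar> / r))"
    have "g \<in> Lip_b T d" unfolding g_def
    proof (rule Lip_b_compose[OF s(2), where C = "1 / r"])
      fix a a' :: real
      have "\<bar>max 0 (1 - \<bar>a - f x\<bar> / r) - max 0 (1 - \<bar>a' - f x\<bar> / r)\<bar>
          \<le> \<bar>\<bar>a - f x\<bar> / r - \<bar>a' - f x\<bar> / r\<bar>" by (auto simp: max_def)
      also have "\<dots> = \<bar>\<bar>a - f x\<bar> - \<bar>a' - f x\<bar>\<bar> / r" using r(1) by (simp flip: diff_divide_distrib)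
      also have "\<dots> \<le> \<bar>a - a'\<bar> / r" using r(1) by (intro divide_right_mono) auto
      finally show "\<bar>max 0 (1 - \<bar>a - f x\<bar> / r) - max 0 (1 - \<bar>a' - f x\<bar> / r)\<bar>
          \<le> 1 / r * \<bar>a - a'\<bar>" by simp
    qed
    moreover have "g y = 0" if "y \<in> topspace T - s" for y
    proof -
      have "f y \<notin> ball (f x) r" using that s r by auto
      hence "1 \<le> \<bar>f y - f x\<bar> / r" using r(1) by (auto simp: dist_real_def abs_minus_commute)
      thus ?thesis by (simp add: g_def)
    qed
    moreover have "g x = 1" "\<And>y. 0 \<le> g y \<and> g y \<le> 1" using r(1) by (auto simp: g_def)
    ultimately show ?case by blast
  qed
qed

text \<open>By compactness finitely many bumps exceed 1/2 somewhere at each point of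
  \<open>C\<close>; doubling their maximum and cutting at 1 gives the value 1 on all of
  \<open>C\<close>.\<close>

lemma Lip_b_separate:
  assumes emt: "emt_space T d" and C: "compactin T C" and U: "openin T U" and CU: "C \<subseteq> U"
  shows "\<exists>g\<in>Lip_b T d. (\<forall>y\<in>C. g y = 1) \<and> (\<forall>y. 0 \<le> g y \<and> g y \<le> 1) \<and> (\<forall>y\<in>topspace T - U. g y = 0)"
proof -
  have "\<forall>x\<in>C. \<exists>g\<in>Lip_b T d. g x = 1 \<and> (\<forall>y. 0 \<le> g y \<and> g y \<le> 1) \<and> (\<forall>y\<in>topspace T - U. g y = 0)"
    using Lip_b_bump[OF emt U] CU by blast
  then obtain G where G: "\<And>x. x \<in> C \<Longrightarrow> G x \<in> Lip_b T d" "\<And>x. x \<in> C \<Longrightarrow> G x x = 1"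
    "\<And>x y. x \<in> C \<Longrightarrow> 0 \<le> G x y \<and> G x y \<le> 1" "\<And>x y. x \<in> C \<Longrightarrow> y \<in> topspace T - U \<Longrightarrow> G x y = 0"
    by metis
  \<comment> \<open>The threshold must lie below 1 for the sets to be open neighbourhoods; 1/2 makes
    the later factor 2 sufficient.\<close>
  define V where "V = (\<lambda>x. {y \<in> topspace T. G x y \<in> {1/2<..}})"
  have Vo: "openin T (V x)" if "x \<in> C" for x
  proof -
    have "continuous_map T euclideanreal (G x)" using G(1)[OF that] by (auto simp: Lip_b_def lip_b_def)
    thus ?thesis unfolding V_def by (rule openin_continuous_map_preimage) auto
  qed
  have "C \<subseteq> \<Union>(V ` C)" using G(2) compactin_subset_topspace[OF C] by (auto simp: V_def)
  then obtain \<F> where "finite \<F>" "\<F> \<subseteq> V ` C" "C \<subseteq> \<Union>\<F>"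
    using compactinD[OF C, of "V ` C"] Vo by auto
  then obtain F where F: "finite F" "F \<subseteq> C" "C \<subseteq> \<Union>(V ` F)"
    by (metis finite_subset_image)
  from F(1,2) have "\<exists>g\<in>Lip_b T d. (\<forall>x\<in>F. \<forall>y\<in>V x. 1/2 < g y) \<and> (\<forall>y. 0 \<le> g y \<and> g y \<le> 1) \<and>
      (\<forall>y\<in>topspace T - U. g y = 0)"
  proof induction
    case empty
    then show ?case by (intro bexI[of _ "\<lambda>_. 0"]) (auto intro: Lip_b_const)
  next
    case (insert x F)
    then obtain g where g: "g \<in> Lip_b T d" "\<And>x y. x \<in> F \<Longrightarrow> y \<in> V x \<Longrightarrow> 1/2 < g y"
      "\<And>y. 0 \<le> g y \<and> g y \<le> 1" "\<And>y. y \<in> topspace T - U \<Longrightarrow> g y = 0" by blast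
    have x: "x \<in> C" using insert by simp
    have "(\<lambda>y. max (g y) (G x y)) \<in> Lip_b T d"
      by (rule Lip_b_combine[OF g(1) G(1)[OF x], where C = 1]) (auto simp: max_def)
    moreover have "1/2 < max (g y) (G x y)" if "z \<in> insert x F" "y \<in> V z" for z y
      using that g(2) by (auto simp: V_def less_max_iff_disj)
    moreover have "0 \<le> max (g y) (G x y) \<and> max (g y) (G x y) \<le> 1" for y
      using g(3)[of y] G(3)[OF x, of y] by auto
    moreover have "max (g y) (G x y) = 0" if "y \<in> topspace T - U" for y
      using g(4)[OF that] G(4)[OF x that] by simp
    ultimately show ?case by (intro bexI[of _ "\<lambda>y. max (g y) (G x y)"] conjI ballI allI) blast+
  qed
  then obtain g where g: "g \<in> Lip_b T d" "\<And>x y. x \<in> F \<Longrightarrow> y \<in> V x \<Longrightarrow> 1/2 < g y"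
      "\<And>y. 0 \<le> g y \<and> g y \<le> 1" "\<And>y. y \<in> topspace T - U \<Longrightarrow> g y = 0" by blast
  have "(\<lambda>y. min 1 (2 * g y)) \<in> Lip_b T d"
    by (rule Lip_b_compose[OF g(1), where C = 2]) (auto simp: min_def abs_if)
  moreover have "min 1 (2 * g y) = 1" if y: "y \<in> C" for y
  proof -
    obtain x where "x \<in> F" "y \<in> V x" using F(3) y by blast
    from g(2)[OF this] show ?thesis by simp
  qed
  ultimately show ?thesis using g(3,4) by (intro bexI[of _ "\<lambda>y. min 1 (2 * g y)"]) auto
qed

section \<open>Lower semicontinuity of the entropy in the Wasserstein distance\<close>

lemma Lip_b_borel_measurable:
  "g \<in> Lip_b T d \<Longrightarrow> sets M = sets (borel_of T) \<Longrightarrow> g \<in> borel_measurable M"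
  by (auto simp: Lip_b_def lip_b_def intro: continuous_map_real_borel_measurable)

lemma Lip_b_bounded:
  assumes "g \<in> Lip_b T d"
  obtains B where "\<And>x. x \<in> topspace T \<Longrightarrow> \<bar>g x\<bar> \<le> B"
  using assms by (auto simp: Lip_b_def lip_b_def bounded_iff)

lemma radon_prob_space:
  assumes "radon_prob T M"
  shows "prob_space M" "sets M = sets (borel_of T)" "space M = topspace T"
  using assms sets_eq_imp_space_eq[of M "borel_of T"] by (auto simp: radon_prob_def space_borel_of)

lemma Lip_b_integrable:
  assumes g: "g \<in> Lip_b T d" and M: "radon_prob T M"
  shows "integrable M g"
proof -
  interpret prob_space M using radon_prob_space[OF M] by simp
  obtain B where "\<And>x. x \<in> topspace T \<Longrightarrow> \<bar>g x\<bar> \<le> B" using Lip_b_bounded[OF g] by blast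
  thus ?thesis using Lip_b_borel_measurable[OF g radon_prob_space(2)[OF M]] radon_prob_space(3)[OF M]
    by (intro integrable_const_bound[of _ B]) auto
qed

lemma radon_prob_compact_approx:
  assumes M: "radon_prob T M" and H: "Hausdorff_space T" and A: "A \<in> sets M" and e: "0 < e"
  obtains C where "compactin T C" "C \<subseteq> A" "C \<in> sets M" "measure M (A - C) < e"
proof -
  interpret prob_space M using radon_prob_space[OF M] by simp
  have "emeasure M A = (SUP C\<in>{C. compactin T C \<and> C \<subseteq> A}. emeasure M C)"
    using M A by (simp add: radon_prob_def)
  moreover have "{C. compactin T C \<and> C \<subseteq> A} \<noteq> {}" using compactin_empty[of T] by blast
  ultimately obtain C where C: "compactin T C" "C \<subseteq> A" "emeasure M A < emeasure M C + ennreal e"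
    using SUP_approx_ennreal[OF e, of "{C. compactin T C \<and> C \<subseteq> A}" "emeasure M A" "emeasure M"]
      emeasure_finite[of A] by (metis (mono_tags, lifting) infinity_ennreal_def mem_Collect_eq)
  have s: "C \<in> sets M"
    using closedin_sets_borel_of[OF compactin_imp_closedin[OF H C(1)]] radon_prob_space(2)[OF M] by simp
  have "measure M A < measure M C + e"
    using C(3) e by (simp add: emeasure_eq_measure ennreal_less_iff flip: ennreal_plus)
  hence "measure M (A - C) < e" using A s C(2) by (simp add: finite_measure_Diff)
  thus ?thesis using that C s by blast
qed

text \<open>The substance is the case of an indicator. Inner regularity gives compact sets inside
  the set and inside its complement which miss little mass, and a Lipschitz function is 1 on the
  former and 0 on the latter.\<close>

lemma Lip_b_dense_L1:
  assumes emt: "emt_space T d" and M: "radon_prob T M" and f: "integrable M (f :: 'a \<Rightarrow> real)"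
  shows "\<forall>e>0. \<exists>g\<in>Lip_b T d. (\<integral>x. \<bar>f x - g x\<bar> \<partial>M) < e"
  using f
proof (induction rule: integrable_induct)
  case (base A c)
  interpret prob_space M using radon_prob_space[OF M] by simp
  have H: "Hausdorff_space T" using emt by (simp add: emt_space_def)
  note sp = radon_prob_space(2,3)[OF M]
  show ?case
  proof (intro allI impI)
    fix e :: real assume e: "0 < e"
    \<comment> \<open>A strict bound keeps the division below legitimate for \<open>c = 0\<close>
      and makes the final estimate strict.\<close>
    obtain k where k: "\<bar>c\<bar> < k" "0 < k" using abs_ge_zero[of c] by (metis gt_ex le_less_trans)
    \<comment> \<open>Each of the two compact approximations misses mass less than \<open>r\<close>,
      and the error is at most \<bar>c\<bar> times their sum.\<close>
    define r where "r = e / (2 * k)"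
    have r: "0 < r" using e k by (simp add: r_def)
    obtain C where C: "compactin T C" "C \<subseteq> A" "C \<in> sets M" "measure M (A - C) < r"
      using radon_prob_compact_approx[OF M H base(1) r] by blast
    have "space M - A \<in> sets M" using base(1) by blast
    then obtain D where D: "compactin T D" "D \<subseteq> space M - A" "D \<in> sets M" "measure M (space M - A - D) < r"
      using radon_prob_compact_approx[OF M H _ r] by blast
    have "openin T (topspace T - D)" using compactin_imp_closedin[OF H D(1)] by (simp add: closedin_def)
    moreover have "C \<subseteq> topspace T - D" using C(2) D(2) compactin_subset_topspace[OF C(1)] by auto
    ultimately have "\<exists>g\<in>Lip_b T d. (\<forall>y\<in>C. g y = 1) \<and> (\<forall>y. 0 \<le> g y \<and> g y \<le> 1) \<and>
        (\<forall>y\<in>topspace T - (topspace T - D). g y = 0)"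
      by (rule Lip_b_separate[OF emt C(1)])
    then obtain g where g: "g \<in> Lip_b T d" "\<And>y. y \<in> C \<Longrightarrow> g y = 1" "\<And>y. 0 \<le> g y \<and> g y \<le> 1"
      "\<And>y. y \<in> topspace T - (topspace T - D) \<Longrightarrow> g y = 0" by blast
    have cg: "(\<lambda>x. c * g x) \<in> Lip_b T d"
      by (rule Lip_b_compose[OF g(1), where C = "\<bar>c\<bar>"]) (simp add: abs_mult flip: right_diff_distrib)
    \<comment> \<open>Off \<open>Z\<close> the function \<open>g\<close> agrees with the indicator
      of \<open>A\<close>; on \<open>Z\<close> the two differ by at most 1.\<close>
    define Z where "Z = (A - C) \<union> (space M - A - D)"
    have Z: "Z \<in> sets M" using base(1) C(3) D(3) by (auto simp: Z_def)
    have "(\<integral>x. \<bar>indicator A x *\<^sub>R c - c * g x\<bar> \<partial>M) \<le> (\<integral>x. \<bar>c\<bar> * indicator Z x \<partial>M)"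
    proof (rule integral_mono)
      show "integrable M (\<lambda>x. \<bar>indicator A x *\<^sub>R c - c * g x\<bar>)"
        using base Lip_b_integrable[OF cg M] by (intro integrable_abs) auto
      show "integrable M (\<lambda>x. \<bar>c\<bar> * indicator Z x)" using Z by (simp add: emeasure_eq_measure)
      fix x assume x: "x \<in> space M"
      have "indicator A x *\<^sub>R c - c * g x = c * (indicator A x - g x)" by (simp add: algebra_simps)
      moreover have "\<bar>indicator A x - g x\<bar> \<le> indicator Z x"
        using x g(2)[of x] g(3)[of x] g(4)[of x] C(2) D(2) sp(2)
        by (auto simp: Z_def indicator_def abs_le_iff)
      ultimately show "\<bar>indicator A x *\<^sub>R c - c * g x\<bar> \<le> \<bar>c\<bar> * indicator Z x"
        by (simp add: abs_mult mult_left_mono)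
    qed
    also have "\<dots> = \<bar>c\<bar> * measure M Z" using Z by simp
    also have "\<dots> \<le> \<bar>c\<bar> * (2 * r)"
    proof -
      have "measure M Z \<le> measure M (A - C) + measure M (space M - A - D)"
        unfolding Z_def using base(1) C(3) D(3) by (intro measure_subadditive) auto
      thus ?thesis using C(4) D(4) by (intro mult_left_mono) auto
    qed
    also have "\<dots> < k * (2 * r)" using r k by simp
    also have "\<dots> = e" using k by (simp add: r_def)
    finally show "\<exists>g\<in>Lip_b T d. (\<integral>x. \<bar>indicator A x *\<^sub>R c - g x\<bar> \<partial>M) < e"
      using cg by (rule bexI[of _ "\<lambda>x. c * g x"])
  qed
next
  case (add f1 f2)
  show ?case
  proof (intro allI impI)
    fix e :: real assume "0 < e"
    hence "0 < e / 2" by simp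
    then obtain g1 g2 where g: "g1 \<in> Lip_b T d" "(\<integral>x. \<bar>f1 x - g1 x\<bar> \<partial>M) < e / 2"
       "g2 \<in> Lip_b T d" "(\<integral>x. \<bar>f2 x - g2 x\<bar> \<partial>M) < e / 2"
      using add.IH by blast
    have s: "(\<lambda>x. g1 x + g2 x) \<in> Lip_b T d"
      by (rule Lip_b_combine[OF g(1,3), where C = 1]) auto
    have i: "integrable M (\<lambda>x. f1 x - g1 x)" "integrable M (\<lambda>x. f2 x - g2 x)"
      using add.hyps Lip_b_integrable[OF g(1) M] Lip_b_integrable[OF g(3) M] by auto
    have "(\<integral>x. \<bar>(f1 x + f2 x) - (g1 x + g2 x)\<bar> \<partial>M) = (\<integral>x. \<bar>(f1 x - g1 x) + (f2 x - g2 x)\<bar> \<partial>M)"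
      by (simp add: algebra_simps)
    also have "\<dots> \<le> (\<integral>x. \<bar>f1 x - g1 x\<bar> + \<bar>f2 x - g2 x\<bar> \<partial>M)"
      using i by (intro integral_mono integrable_abs Bochner_Integration.integrable_add) auto
    also have "\<dots> = (\<integral>x. \<bar>f1 x - g1 x\<bar> \<partial>M) + (\<integral>x. \<bar>f2 x - g2 x\<bar> \<partial>M)"
      using i by (intro Bochner_Integration.integral_add integrable_abs) auto
    finally show "\<exists>g\<in>Lip_b T d. (\<integral>x. \<bar>f1 x + f2 x - g x\<bar> \<partial>M) < e"
      using g s by (intro bexI[of _ "\<lambda>x. g1 x + g2 x"]) auto
  qed
next
  case (lim f s)
  show ?case
  proof (intro allI impI)
    fix e :: real assume e: "0 < e"
    have [measurable]: "f \<in> borel_measurable M" "\<And>i. s i \<in> borel_measurable M" using lim.hyps by auto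
    have "(\<lambda>i. \<integral>x. \<bar>f x - s i x\<bar> \<partial>M) \<longlonglongrightarrow> (\<integral>x. 0 \<partial>M)"
    proof (rule integral_dominated_convergence)
      \<comment> \<open>The approximating simple functions satisfy \<bar>s i x\<bar> \<le> 2 \<bar>f
        x\<bar>, hence the factor 3.\<close>
      show "integrable M (\<lambda>x. 3 * \<bar>f x\<bar>)" using lim.hyps by simp
      show "AE x in M. (\<lambda>i. \<bar>f x - s i x\<bar>) \<longlonglongrightarrow> 0"
      proof (rule AE_I2)
        fix x assume "x \<in> space M"
        from lim.hyps(2)[OF this] have "(\<lambda>i. \<bar>f x - s i x\<bar>) \<longlonglongrightarrow> \<bar>f x - f x\<bar>" by (intro tendsto_intros)
        thus "(\<lambda>i. \<bar>f x - s i x\<bar>) \<longlonglongrightarrow> 0" by simp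
      qed
      show "AE x in M. norm \<bar>f x - s i x\<bar> \<le> 3 * \<bar>f x\<bar>" for i
      proof (rule AE_I2)
        fix x assume "x \<in> space M"
        from lim.hyps(3)[OF this, of i] show "norm \<bar>f x - s i x\<bar> \<le> 3 * \<bar>f x\<bar>" by simp
      qed
    qed auto
    hence "\<forall>\<^sub>F i in sequentially. (\<integral>x. \<bar>f x - s i x\<bar> \<partial>M) < e / 2"
      using e by (intro order_tendstoD(2)) auto
    then obtain i where i: "(\<integral>x. \<bar>f x - s i x\<bar> \<partial>M) < e / 2" using eventually_happens by force
    have "0 < e / 2" using e by simp
    then obtain g where g: "g \<in> Lip_b T d" "(\<integral>x. \<bar>s i x - g x\<bar> \<partial>M) < e / 2" using lim.IH by blast
    have ii: "integrable M (\<lambda>x. f x - s i x)" "integrable M (\<lambda>x. s i x - g x)"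
      using lim.hyps Lip_b_integrable[OF g(1) M] by auto
    have "(\<integral>x. \<bar>f x - g x\<bar> \<partial>M) = (\<integral>x. \<bar>(f x - s i x) + (s i x - g x)\<bar> \<partial>M)"
      by (simp add: algebra_simps)
    also have "\<dots> \<le> (\<integral>x. \<bar>f x - s i x\<bar> + \<bar>s i x - g x\<bar> \<partial>M)"
      using Bochner_Integration.integrable_add[OF ii] ii
      by (intro integral_mono integrable_abs Bochner_Integration.integrable_add) auto
    also have "\<dots> = (\<integral>x. \<bar>f x - s i x\<bar> \<partial>M) + (\<integral>x. \<bar>s i x - g x\<bar> \<partial>M)"
      using ii by (intro Bochner_Integration.integral_add integrable_abs) auto
    finally show "\<exists>g\<in>Lip_b T d. (\<integral>x. \<bar>f x - g x\<bar> \<partial>M) < e" using g i by (intro bexI[of _ g]) auto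
  qed
qed

section \<open>Lipschitz test functions against the Wasserstein distance\<close>

lemma ennreal_power2_le_iff: "(a::ennreal)\<^sup>2 \<le> b\<^sup>2 \<longleftrightarrow> a \<le> b"
proof
  assume le: "a\<^sup>2 \<le> b\<^sup>2"
  show "a \<le> b"
  proof (cases b)
    case (real s)
    have "b\<^sup>2 \<noteq> \<top>" using real by (simp add: ennreal_power)
    hence "a \<noteq> \<top>" using le by (auto simp: power2_eq_square ennreal_top_mult top_unique)
    then obtain r where r: "a = ennreal r" "0 \<le> r" by (metis ennreal_cases)
    have "r\<^sup>2 \<le> s\<^sup>2" using le r real by (simp add: ennreal_power)
    thus ?thesis using r real by (auto intro!: ennreal_leI dest: power2_le_imp_le)
  qed simp
qed (simp add: power_mono)

lemma W2sq_eq: "W2sq T d \<mu> \<nu> = (W2 T d \<mu> \<nu>)\<^sup>2"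
proof (cases "W2sq T d \<mu> \<nu>")
  case (real r)
  then show ?thesis by (simp add: W2_def ennreal_power)
next
  case top
  then show ?thesis by (simp add: W2_def power2_eq_square ennreal_top_mult)
qed

text \<open>The difference of the integrals is the mean of g(x) - g(y) under the coupling, and the
  square of a mean is at most the mean of the square because variances are nonnegative.\<close>

lemma coupling_integral_diff:
  assumes \<pi>: "\<pi> \<in> couplings T \<mu> \<nu>" and \<mu>: "radon_prob T \<mu>" and \<nu>: "radon_prob T \<nu>"
    and g: "g \<in> Lip_b T d"
  shows "ennreal (((\<integral>x. g x \<partial>\<mu>) - (\<integral>x. g x \<partial>\<nu>))\<^sup>2) \<le> (\<integral>\<^sup>+p. ennreal ((g (fst p) - g (snd p))\<^sup>2) \<partial>\<pi>)"
proof -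
  have r: "radon_prob (prod_topology T T) \<pi>" using \<pi> by (simp add: couplings_def)
  interpret prob_space \<pi> using radon_prob_space[OF r] by simp
  note sp = radon_prob_space(2,3)[OF r]
  \<comment> \<open>A coupling lives on the Borel sets of the product topology, so the projections
    are measurable by continuity.\<close>
  have f[measurable]: "fst \<in> measurable \<pi> (borel_of T)" and s[measurable]: "snd \<in> measurable \<pi> (borel_of T)"
    using continuous_map_borel_of_measurable[OF continuous_map_fst[of T T]]
      continuous_map_borel_of_measurable[OF continuous_map_snd[of T T]] measurable_cong_sets[OF sp(1) refl] by auto
  have d1: "distr \<pi> (borel_of T) fst = \<mu>"
  proof (rule measure_eqI)
    fix A assume "A \<in> sets (distr \<pi> (borel_of T) fst)"
    hence A: "A \<in> sets (borel_of T)" by simp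
    have "fst -` A \<inter> space \<pi> = A \<times> topspace T"
      using sets.sets_into_space[OF A] by (auto simp: sp space_borel_of)
    thus "emeasure (distr \<pi> (borel_of T) fst) A = emeasure \<mu> A"
      using A \<pi> by (simp add: emeasure_distr couplings_def)
  qed (simp add: radon_prob_space[OF \<mu>])
  have d2: "distr \<pi> (borel_of T) snd = \<nu>"
  proof (rule measure_eqI)
    fix A assume "A \<in> sets (distr \<pi> (borel_of T) snd)"
    hence A: "A \<in> sets (borel_of T)" by simp
    have "snd -` A \<inter> space \<pi> = topspace T \<times> A"
      using sets.sets_into_space[OF A] by (auto simp: sp space_borel_of)
    thus "emeasure (distr \<pi> (borel_of T) snd) A = emeasure \<nu> A"
      using A \<pi> by (simp add: emeasure_distr couplings_def)
  qed (simp add: radon_prob_space[OF \<nu>])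
  have gm[measurable]: "g \<in> borel_measurable (borel_of T)" using Lip_b_borel_measurable[OF g refl] .
  obtain B where B: "\<And>x. x \<in> topspace T \<Longrightarrow> \<bar>g x\<bar> \<le> B" using Lip_b_bounded[OF g] by blast
  define h where "h = (\<lambda>p. g (fst p) - g (snd p))"
  have [measurable]: "h \<in> borel_measurable \<pi>" by (simp add: h_def)
  have i: "integrable \<pi> (\<lambda>p. g (fst p))" "integrable \<pi> (\<lambda>p. g (snd p))"
    using B sp by (auto intro!: integrable_const_bound[of _ B])
  have hB: "\<bar>h p\<bar> \<le> 2 * B" if "p \<in> space \<pi>" for p
  proof -
    have "fst p \<in> topspace T" "snd p \<in> topspace T" using that by (auto simp: sp)
    from B[OF this(1)] B[OF this(2)] show ?thesis by (simp add: h_def)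
  qed
  have i2: "integrable \<pi> (\<lambda>p. (h p)\<^sup>2)"
  proof (rule integrable_const_bound[of _ "(2 * B)\<^sup>2"])
    show "AE p in \<pi>. norm ((h p)\<^sup>2) \<le> (2 * B)\<^sup>2"
    proof (rule AE_I2)
      fix p assume "p \<in> space \<pi>"
      from power_mono[OF hB[OF this], of 2] show "norm ((h p)\<^sup>2) \<le> (2 * B)\<^sup>2" by simp
    qed
  qed simp
  have "(\<integral>p. h p \<partial>\<pi>) = (\<integral>p. g (fst p) \<partial>\<pi>) - (\<integral>p. g (snd p) \<partial>\<pi>)" using i by (simp add: h_def)
  also have "(\<integral>p. g (fst p) \<partial>\<pi>) = (\<integral>x. g x \<partial>\<mu>)" by (subst d1[symmetric]) (simp add: integral_distr)
  also have "(\<integral>p. g (snd p) \<partial>\<pi>) = (\<integral>x. g x \<partial>\<nu>)" by (subst d2[symmetric]) (simp add: integral_distr)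
  finally have e: "(\<integral>p. h p \<partial>\<pi>) = (\<integral>x. g x \<partial>\<mu>) - (\<integral>x. g x \<partial>\<nu>)" .
  have "integrable \<pi> h" using i by (simp add: h_def)
  from variance_eq[OF this i2] have "(\<integral>p. h p \<partial>\<pi>)\<^sup>2 \<le> (\<integral>p. (h p)\<^sup>2 \<partial>\<pi>)"
    using variance_positive[of h] by simp
  hence "ennreal ((\<integral>p. h p \<partial>\<pi>)\<^sup>2) \<le> ennreal (\<integral>p. (h p)\<^sup>2 \<partial>\<pi>)" by (rule ennreal_leI)
  also have "\<dots> = (\<integral>\<^sup>+p. ennreal ((h p)\<^sup>2) \<partial>\<pi>)" using i2 by (subst nn_integral_eq_integral) auto
  finally show ?thesis unfolding e by (simp add: h_def)
qed

text \<open>The elementary half of Kantorovich duality, with the quadratic cost in place of the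
  linear one.\<close>

lemma Lip_b_integral_W2_bound:
  assumes g: "g \<in> Lip_b T d"
  obtains L where "0 < L" "\<And>\<mu> \<nu>. radon_prob T \<mu> \<Longrightarrow> radon_prob T \<nu> \<Longrightarrow> 
    ennreal \<bar>(\<integral>x. g x \<partial>\<mu>) - (\<integral>x. g x \<partial>\<nu>)\<bar> \<le> ennreal L * W2 T d \<mu> \<nu>"
proof -
  obtain L0 where L0: "\<And>x y. x \<in> topspace T \<Longrightarrow> y \<in> topspace T \<Longrightarrow> ennreal \<bar>g x - g y\<bar> \<le> ennreal L0 * d x y"
    using g by (auto simp: Lip_b_def lip_b_def)
  \<comment> \<open>The maximum with 1 makes the constant positive, so that the function can be
    rescaled to be 1-Lipschitz.\<close>
  define L where "L = max L0 1"
  have L: "0 < L" by (simp add: L_def)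
  have Lip: "ennreal (\<bar>g x - g y\<bar> / L) \<le> d x y" if "x \<in> topspace T" "y \<in> topspace T" for x y
  proof -
    have "ennreal L0 \<le> ennreal L" by (intro ennreal_leI) (simp add: L_def)
    hence le: "ennreal \<bar>g x - g y\<bar> \<le> ennreal L * d x y"
      using L0[OF that] by (meson mult_right_mono order_trans zero_le)
    show ?thesis
    proof (cases "d x y")
      case (real r)
      hence "\<bar>g x - g y\<bar> \<le> L * r" using le L by (simp flip: ennreal_mult)
      thus ?thesis using L real by (auto simp: divide_le_eq mult.commute intro!: ennreal_leI)
    qed simp
  qed
  have "ennreal \<bar>(\<integral>x. g x \<partial>\<mu>) - (\<integral>x. g x \<partial>\<nu>)\<bar> \<le> ennreal L * W2 T d \<mu> \<nu>"
    if \<mu>: "radon_prob T \<mu>" and \<nu>: "radon_prob T \<nu>" for \<mu> \<nu>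
  proof -
    define g' where "g' = (\<lambda>x. g x / L)"
    have g': "g' \<in> Lip_b T d" unfolding g'_def using L
      by (intro Lip_b_compose[OF g, where C = "1 / L"]) (simp flip: diff_divide_distrib)
    let ?D = "(\<integral>x. g' x \<partial>\<mu>) - (\<integral>x. g' x \<partial>\<nu>)"
    have "ennreal (?D\<^sup>2) \<le> W2sq T d \<mu> \<nu>"
      unfolding W2sq_def
    proof (rule INF_greatest)
      fix \<pi> assume \<pi>: "\<pi> \<in> couplings T \<mu> \<nu>"
      have r: "radon_prob (prod_topology T T) \<pi>" using \<pi> by (simp add: couplings_def)
      have "ennreal (?D\<^sup>2) \<le> (\<integral>\<^sup>+p. ennreal ((g' (fst p) - g' (snd p))\<^sup>2) \<partial>\<pi>)"
        by (rule coupling_integral_diff[OF \<pi> \<mu> \<nu> g'])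
      also have "\<dots> \<le> (\<integral>\<^sup>+p. (d (fst p) (snd p))\<^sup>2 \<partial>\<pi>)"
      proof (rule nn_integral_mono)
        fix p assume "p \<in> space \<pi>"
        hence p: "fst p \<in> topspace T" "snd p \<in> topspace T" by (auto simp: radon_prob_space[OF r])
        have "\<bar>g' (fst p) - g' (snd p)\<bar> = \<bar>g (fst p) - g (snd p)\<bar> / L"
          using L by (simp add: g'_def flip: diff_divide_distrib)
        hence "(ennreal \<bar>g' (fst p) - g' (snd p)\<bar>)\<^sup>2 \<le> (d (fst p) (snd p))\<^sup>2"
          using Lip[OF p] by (intro power_mono) auto
        thus "ennreal ((g' (fst p) - g' (snd p))\<^sup>2) \<le> (d (fst p) (snd p))\<^sup>2"
          by (simp add: ennreal_power)
      qed
      finally show "ennreal (?D\<^sup>2) \<le> (\<integral>\<^sup>+p. (d (fst p) (snd p))\<^sup>2 \<partial>\<pi>)" .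
    qed
    hence "(ennreal \<bar>?D\<bar>)\<^sup>2 \<le> (W2 T d \<mu> \<nu>)\<^sup>2" by (simp add: W2sq_eq ennreal_power)
    hence le: "ennreal \<bar>?D\<bar> \<le> W2 T d \<mu> \<nu>" by (simp add: ennreal_power2_le_iff)
    have "(\<integral>x. g x \<partial>\<mu>) - (\<integral>x. g x \<partial>\<nu>) = L * ?D" using L by (simp add: g'_def diff_divide_distrib[symmetric])
    hence "ennreal \<bar>(\<integral>x. g x \<partial>\<mu>) - (\<integral>x. g x \<partial>\<nu>)\<bar> = ennreal L * ennreal \<bar>?D\<bar>"
      using L by (simp add: abs_mult ennreal_mult)
    also have "\<dots> \<le> ennreal L * W2 T d \<mu> \<nu>" using le by (intro mult_left_mono) auto
    finally show ?thesis .
  qed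
  with L show ?thesis using that by blast
qed

text \<open>A bounded test function with dual value above \<open>c\<close> can be replaced by a
  Lipschitz one. Its dual value varies continuously with respect to \<open>W2\<close> and bounds the
  entropy of every nearby measure from below.\<close>

lemma Ent_W2_lsc:
  assumes emt: "emt_space T d" and m: "radon_prob T m" and \<mu>: "radon_prob T \<mu>"
    and fin: "Ent m \<mu> < \<infinity>" and c: "ereal c < Ent m \<mu>"
  obtains \<delta> where "0 < \<delta>" "\<And>\<nu>. radon_prob T \<nu> \<Longrightarrow> W2 T d \<nu> \<mu> < ennreal \<delta> \<Longrightarrow> ereal c < Ent m \<nu>"
proof -
  note mp = radon_prob_space[OF m] and \<mu>p = radon_prob_space[OF \<mu>]
  interpret m: prob_space m by (rule mp)
  interpret \<mu>: prob_space \<mu> by (rule \<mu>p)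
  have ac: "absolutely_continuous m \<mu>" using fin by (auto simp: Ent_def split: if_splits)
  have s\<mu>: "sets \<mu> = sets m" using mp \<mu>p by simp
  obtain \<phi> B where \<phi>[measurable]: "\<phi> \<in> borel_measurable m" and B: "\<And>x. \<bar>\<phi> x\<bar> \<le> B"
    and c\<phi>: "c < (\<integral>x. \<phi> x \<partial>\<mu>) - (\<integral>x. exp (\<phi> x - 1) \<partial>m)"
    using Ent_less_dual[OF mp(1) \<mu>p(1) fin c] by blast
  have \<phi>i: "integrable m \<phi>" using B by (intro m.integrable_const_bound[of _ B]) auto
  have "\<exists>g\<in>Lip_b T d. (\<forall>x. \<bar>g x\<bar> \<le> B) \<and> (\<integral>x. \<bar>\<phi> x - g x\<bar> \<partial>m) < 1 / real (Suc n)" for n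
  proof -
    obtain g where g: "g \<in> Lip_b T d" "(\<integral>x. \<bar>\<phi> x - g x\<bar> \<partial>m) < 1 / real (Suc n)"
      using Lip_b_dense_L1[OF emt m \<phi>i] by (meson of_nat_0_less_iff zero_less_Suc zero_less_divide_1_iff)
    \<comment> \<open>Clipping to [-B, B] does not increase the error, since \<phi> takes values
      there; the uniform bound is what dominated convergence needs below.\<close>
    define h where "h = (\<lambda>x. max (- B) (min B (g x)))"
    have h: "h \<in> Lip_b T d" unfolding h_def
      by (rule Lip_b_compose[OF g(1), where C = 1]) (auto simp: max_def min_def)
    have hB: "\<bar>h x\<bar> \<le> B" for x using order_trans[OF abs_ge_zero B[of x]] by (auto simp: h_def max_def min_def)
    have "(\<integral>x. \<bar>\<phi> x - h x\<bar> \<partial>m) \<le> (\<integral>x. \<bar>\<phi> x - g x\<bar> \<partial>m)"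
    proof (rule integral_mono)
      show "integrable m (\<lambda>x. \<bar>\<phi> x - h x\<bar>)" "integrable m (\<lambda>x. \<bar>\<phi> x - g x\<bar>)"
        using \<phi>i Lip_b_integrable[OF h m] Lip_b_integrable[OF g(1) m] by auto
      fix x show "\<bar>\<phi> x - h x\<bar> \<le> \<bar>\<phi> x - g x\<bar>" using B[of x] by (auto simp: h_def max_def min_def)
    qed
    thus ?thesis using g h hB by (intro bexI[of _ h]) auto
  qed
  then obtain G where G: "\<And>n. G n \<in> Lip_b T d" "\<And>n x. \<bar>G n x\<bar> \<le> B"
    "\<And>n. (\<integral>x. \<bar>\<phi> x - G n x\<bar> \<partial>m) < 1 / real (Suc n)" by metis
  have Gm[measurable]: "G n \<in> borel_measurable m" for n using Lip_b_borel_measurable[OF G(1) mp(2)] .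
  have G\<mu>: "G n \<in> borel_measurable \<mu>" for n using Lip_b_borel_measurable[OF G(1) \<mu>p(2)] .
  have "(\<lambda>n. \<integral>x. norm (\<phi> x - G n x) \<partial>m) \<longlonglongrightarrow> 0"
  proof (rule tendsto_sandwich[OF _ _ tendsto_const lim_1_over_n[THEN LIMSEQ_Suc]])
    show "\<forall>\<^sub>F n in sequentially. (\<integral>x. norm (\<phi> x - G n x) \<partial>m) \<le> 1 / real (Suc n)"
      using G(3) by (auto intro!: always_eventually less_imp_le)
  qed auto
  moreover have "integrable m (\<lambda>x. \<phi> x - G n x)" for n using \<phi>i Lip_b_integrable[OF G(1) m] by auto
  \<comment> \<open>L1 convergence with respect to \<open>m\<close> says nothing directly about
    \<mu>, whose density may be unbounded. Almost everywhere convergence along a subsequence does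
    pass to \<mu>, by absolute continuity.\<close>
  ultimately obtain r :: "nat \<Rightarrow> nat" where r: "AE x in m. (\<lambda>n. \<phi> x - G (r n) x) \<longlonglongrightarrow> 0"
    using tendsto_L1_AE_subseq[of m "\<lambda>n x. \<phi> x - G n x"] by blast
  have ae: "AE x in m. (\<lambda>n. G (r n) x) \<longlonglongrightarrow> \<phi> x"
    using r
  proof eventually_elim
    case (elim x)
    have "(\<lambda>n. \<phi> x - (\<phi> x - G (r n) x)) \<longlonglongrightarrow> \<phi> x - 0" using elim by (intro tendsto_intros)
    thus ?case by simp
  qed
  have ae\<mu>: "AE x in \<mu>. (\<lambda>n. G (r n) x) \<longlonglongrightarrow> \<phi> x"
    using absolutely_continuous_AE[OF s\<mu> ac ae] .
  have "(\<lambda>n. \<integral>x. G (r n) x \<partial>\<mu>) \<longlonglongrightarrow> (\<integral>x. \<phi> x \<partial>\<mu>)"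
    using ae\<mu> G(2) G\<mu> \<phi> by (intro integral_dominated_convergence[where w = "\<lambda>_. B"]) (auto simp: measurable_cong_sets[OF s\<mu> refl])
  moreover have "(\<lambda>n. \<integral>x. exp (G (r n) x - 1) \<partial>m) \<longlonglongrightarrow> (\<integral>x. exp (\<phi> x - 1) \<partial>m)"
  proof (rule integral_dominated_convergence[where w = "\<lambda>_. exp (B - 1)"])
    show "AE x in m. (\<lambda>n. exp (G (r n) x - 1)) \<longlonglongrightarrow> exp (\<phi> x - 1)"
      using ae by eventually_elim (intro tendsto_intros)
    show "AE x in m. norm (exp (G (r n) x - 1)) \<le> exp (B - 1)" for n
      using G(2)[of "r n"] by (auto simp: abs_le_iff)
  qed auto
  ultimately have "(\<lambda>n. (\<integral>x. G (r n) x \<partial>\<mu>) - (\<integral>x. exp (G (r n) x - 1) \<partial>m)) \<longlonglongrightarrow>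
      (\<integral>x. \<phi> x \<partial>\<mu>) - (\<integral>x. exp (\<phi> x - 1) \<partial>m)" by (rule tendsto_diff)
  hence "\<forall>\<^sub>F n in sequentially. c < (\<integral>x. G (r n) x \<partial>\<mu>) - (\<integral>x. exp (G (r n) x - 1) \<partial>m)"
    using c\<phi> by (rule order_tendstoD(1))
  then obtain n where n: "c < (\<integral>x. G (r n) x \<partial>\<mu>) - (\<integral>x. exp (G (r n) x - 1) \<partial>m)"
    using eventually_happens by force
  define g where "g = G (r n)"
  have g: "g \<in> Lip_b T d" "\<And>x. \<bar>g x\<bar> \<le> B" using G by (auto simp: g_def)
  \<comment> \<open>The slack that a perturbation of \<mu> may consume; with the Lipschitz constant
    \<open>L\<close> this yields the radius \<eta> / L.\<close>
  define \<eta> where "\<eta> = (\<integral>x. g x \<partial>\<mu>) - (\<integral>x. exp (g x - 1) \<partial>m) - c"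
  have \<eta>: "0 < \<eta>" using n by (simp add: \<eta>_def g_def)
  obtain L where L: "0 < L" "\<And>\<mu> \<nu>. radon_prob T \<mu> \<Longrightarrow> radon_prob T \<nu> \<Longrightarrow> 
    ennreal \<bar>(\<integral>x. g x \<partial>\<mu>) - (\<integral>x. g x \<partial>\<nu>)\<bar> \<le> ennreal L * W2 T d \<mu> \<nu>"
    using Lip_b_integral_W2_bound[OF g(1)] by blast
  have "ereal c < Ent m \<nu>" if \<nu>: "radon_prob T \<nu>" and W: "W2 T d \<nu> \<mu> < ennreal (\<eta> / L)" for \<nu>
  proof -
    have "ennreal \<bar>(\<integral>x. g x \<partial>\<nu>) - (\<integral>x. g x \<partial>\<mu>)\<bar> \<le> ennreal L * W2 T d \<nu> \<mu>" using L(2)[OF \<nu> \<mu>] .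
    also have "\<dots> < ennreal L * ennreal (\<eta> / L)"
      using W L(1) by (intro ennreal_mult_strict_left_mono) auto
    also have "\<dots> = ennreal \<eta>" using L(1) \<eta> by (simp flip: ennreal_mult)
    finally have "\<bar>(\<integral>x. g x \<partial>\<nu>) - (\<integral>x. g x \<partial>\<mu>)\<bar> < \<eta>" by (simp add: ennreal_less_iff)
    hence "c < (\<integral>x. g x \<partial>\<nu>) - (\<integral>x. exp (g x - 1) \<partial>m)" by (simp add: \<eta>_def abs_less_iff)
    hence "ereal c < ereal ((\<integral>x. g x \<partial>\<nu>) - (\<integral>x. exp (g x - 1) \<partial>m))" by simp
    also have "\<dots> \<le> Ent m \<nu>"
      using g Gm[of "r n"] by (intro Ent_ge_dual[OF mp(1) radon_prob_space(1)[OF \<nu>], where B = B]) (auto simp: g_def)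
    finally show ?thesis .
  qed
  thus ?thesis using that[of "\<eta> / L"] \<eta> L(1) by simp
qed

section \<open>Barycenters\<close>

text \<open>The distance to a fixed point is a supremum of continuous functions, so its strict
  superlevel sets are open although the distance itself may be discontinuous for the
  topology.\<close>

lemma emt_space_dist_borel_measurable:
  assumes emt: "emt_space S dS" and M: "sets M = sets (borel_of S)" and y: "y \<in> topspace S"
  shows "(\<lambda>x. dS x y) \<in> borel_measurable M"
proof (rule borel_measurableI_greater)
  fix a :: ennreal
  have sp: "space M = topspace S" using sets_eq_imp_space_eq[OF M] by (simp add: space_borel_of)
  define W where "W = (\<lambda>f::'a \<Rightarrow> real. {x \<in> topspace S. f x \<in> {r. a < ennreal \<bar>r - f y\<bar>}})"
  have "openin S (W f)" if "f \<in> lip_b S dS 1" for f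
    unfolding W_def
  proof (rule openin_continuous_map_preimage)
    show "continuous_map S euclideanreal f" using that by (simp add: lip_b_def)
    show "openin euclideanreal {r. a < ennreal \<bar>r - f y\<bar>}"
      unfolding open_openin[symmetric]
      by (intro open_Collect_less continuous_on_const continuous_on_ennreal continuous_intros)
  qed
  hence "openin S (\<Union>(W ` lip_b S dS 1))" by blast
  moreover have "\<Union>(W ` lip_b S dS 1) = {x \<in> space M. a < dS x y}"
    using emt y by (auto simp: W_def sp emt_space_def less_SUP_iff)
  ultimately show "{x \<in> space M. a < dS x y} \<in> sets M"
    using openin_sets_borel_of M by metis
qed

text \<open>The integrand \<open>g\<close> need not be measurable, in which case its \<open>nn_integral\<close> is the lower integral.
  This is how the entropy enters, since it is not assumed to be measurable on the space of measures.\<close>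

lemma nn_integral_le_add_nonmeasurable:
  assumes [measurable]: "h \<in> borel_measurable M" "f \<in> borel_measurable M"
    and fin: "(\<integral>\<^sup>+x. f x \<partial>M) < \<infinity>" and le: "\<And>x. x \<in> space M \<Longrightarrow> h x \<le> f x + g x"
  shows "(\<integral>\<^sup>+x. h x \<partial>M) \<le> (\<integral>\<^sup>+x. f x \<partial>M) + (\<integral>\<^sup>+x. g x \<partial>M)"
proof -
  have ae: "AE x in M. f x \<noteq> \<infinity>" using fin by (intro nn_integral_PInf_AE) auto
  \<comment> \<open>The truncated difference \<open>h - f\<close> is measurable and lies below
    \<open>g\<close> wherever \<open>f\<close> is finite, so additivity is needed for measurable
    functions only.\<close>
  have "(\<integral>\<^sup>+x. h x \<partial>M) \<le> (\<integral>\<^sup>+x. f x + (h x - f x) \<partial>M)"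
  proof (rule nn_integral_mono)
    fix x show "h x \<le> f x + (h x - f x)"
      by (metis add.commute add_diff_eq_iff_ennreal diff_add_cancel_ennreal le_cases le_iff_add order_refl order_trans)
  qed
  also have "\<dots> = (\<integral>\<^sup>+x. f x \<partial>M) + (\<integral>\<^sup>+x. h x - f x \<partial>M)" by (rule nn_integral_add) auto
  also have "(\<integral>\<^sup>+x. h x - f x \<partial>M) \<le> (\<integral>\<^sup>+x. g x \<partial>M)"
  proof (rule nn_integral_mono_AE)
    show "AE x in M. h x - f x \<le> g x"
      using ae AE_space
    proof eventually_elim
      case (elim x)
      thus ?case using le[of x] by (auto simp: ennreal_minus_le_iff)
    qed
  qed
  finally show ?thesis by (simp add: add_left_mono)
qed

section \<open>The flow started at a fixed barycenter\<close>

context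
  fixes K :: real
    and T :: "'a topology" and d :: "'a \<Rightarrow> 'a \<Rightarrow> ennreal" and m :: "'a measure"
    and S :: "'a measure topology" and \<Omega> :: "'a measure measure" and \<mu>b :: "'a measure"
  assumes emm: "emm_space T d m"
    and S_top: "topspace S = Pspace T"
    and S_emt: "emt_space S (W2 T d)"
    and \<Omega>_radon: "radon_prob S \<Omega>"
    and finite_var: "variance T d \<Omega> < \<infinity>"
    and EVI: "\<forall>\<mu>\<in>Pspace T. (\<exists>\<nu>\<in>Pspace T. Ent m \<nu> < \<infinity> \<and> W2 T d \<mu> \<nu> < \<infinity>) \<longrightarrow>
                 (\<exists>y. EVI_flow (Pspace T) (W2 T d) (Ent m) K \<mu> y)"
    and bary: "barycenter T d \<Omega> \<mu>b"
begin

private lemma W2_metric: "ext_metric (Pspace T) (W2 T d)"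
  using S_emt S_top by (simp add: emt_space_def)

private lemma W2_sym: "\<mu> \<in> Pspace T \<Longrightarrow> \<nu> \<in> Pspace T \<Longrightarrow> W2 T d \<mu> \<nu> = W2 T d \<nu> \<mu>"
  using W2_metric by (simp add: ext_metric_def)

private lemma W2sq_measurable: "\<nu> \<in> Pspace T \<Longrightarrow> (\<lambda>\<mu>. W2sq T d \<mu> \<nu>) \<in> borel_measurable \<Omega>"
  unfolding W2sq_eq
  using emt_space_dist_borel_measurable[OF S_emt radon_prob_space(2)[OF \<Omega>_radon]] S_top by simp

private lemma space_Omega: "space \<Omega> = Pspace T"
  using radon_prob_space(3)[OF \<Omega>_radon] S_top by simp

private lemma bary_Pspace: "\<mu>b \<in> Pspace T"
  using bary by (simp add: barycenter_def)

text \<open>The barycenter is the second argument of the cost in its definition and the first one in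
  the final inequality; symmetry of the distance reconciles the two.\<close>

private lemma W2sq_integral_finite:
  "\<exists>v\<ge>0. (\<integral>\<^sup>+ \<mu>. W2sq T d \<mu> \<mu>b \<partial>\<Omega>) = ennreal v \<and> (\<integral>\<^sup>+ \<mu>. W2sq T d \<mu>b \<mu> \<partial>\<Omega>) = ennreal v"
proof -
  have "(\<integral>\<^sup>+ \<mu>. W2sq T d \<mu>b \<mu> \<partial>\<Omega>) = (\<integral>\<^sup>+ \<mu>. W2sq T d \<mu> \<mu>b \<partial>\<Omega>)"
    using W2_sym[OF bary_Pspace] by (intro nn_integral_cong) (simp add: W2sq_eq space_Omega)
  thus ?thesis using bary finite_var by (cases "variance T d \<Omega>") (auto simp: barycenter_def)
qed

private lemma Ent_Pspace_nonneg: "\<mu> \<in> Pspace T \<Longrightarrow> 0 \<le> Ent m \<mu>"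
  using emm by (auto simp: emm_space_def Pspace_def intro!: Ent_nonneg radon_prob_space(1))

text \<open>Almost every measure is at finite distance from the barycenter. If none of these had
  finite entropy, the entropy would be infinite almost everywhere and so would be its
  integral.\<close>

lemma barycenter_EVI_flow:
  assumes fin: "(\<integral>\<^sup>+\<mu>. e2ennreal (Ent m \<mu>) \<partial>\<Omega>) < \<infinity>"
  shows "\<exists>y. EVI_flow (Pspace T) (W2 T d) (Ent m) K \<mu>b y"
proof -
  have "\<exists>\<nu>\<in>Pspace T. Ent m \<nu> < \<infinity> \<and> W2 T d \<mu>b \<nu> < \<infinity>"
  proof (rule ccontr)
    assume no: "\<not> ?thesis"
    have "(\<integral>\<^sup>+\<mu>. W2sq T d \<mu> \<mu>b \<partial>\<Omega>) \<noteq> \<infinity>" using bary finite_var by (simp add: barycenter_def)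
    hence "AE \<mu> in \<Omega>. W2sq T d \<mu> \<mu>b \<noteq> \<infinity>"
      using W2sq_measurable[OF bary_Pspace] by (intro nn_integral_PInf_AE) auto
    hence "AE \<mu> in \<Omega>. \<top> \<le> e2ennreal (Ent m \<mu>)"
      using AE_space
    proof eventually_elim
      case (elim \<mu>)
      have "\<mu> \<in> Pspace T" using elim(2) by (simp add: space_Omega)
      moreover have "W2 T d \<mu> \<mu>b < \<infinity>" using elim(1) by (auto simp: W2_def)
      ultimately have "\<not> Ent m \<mu> < \<infinity>" using no W2_sym[OF _ bary_Pspace, of \<mu>] by auto
      thus ?case by simp
    qed
    hence "(\<integral>\<^sup>+\<mu>. \<top> \<partial>\<Omega>) \<le> (\<integral>\<^sup>+\<mu>. e2ennreal (Ent m \<mu>) \<partial>\<Omega>)" by (rule nn_integral_mono_AE)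
    moreover have "(\<integral>\<^sup>+\<mu>. \<top> \<partial>\<Omega>) = \<top>"
      using prob_space.emeasure_space_1[OF radon_prob_space(1)[OF \<Omega>_radon]] by simp
    ultimately show False using fin by (simp add: top_unique)
  qed
  thus ?thesis using EVI bary_Pspace by blast
qed

text \<open>Inside the domain this is lower semicontinuity along the convergence to the starting
  point; outside it is the liminf condition in the definition of the flow.\<close>

private lemma flow_energy_lower:
  assumes flow: "EVI_flow (Pspace T) (W2 T d) (Ent m) K \<mu>b y" and c: "ereal c < Ent m \<mu>b"
  shows "\<forall>\<^sub>F t in at_right 0. ereal c < Ent m (y t)"
proof (cases "\<mu>b \<in> dom_E (Pspace T) (Ent m)")
  case True
  have "emt_space T d" "radon_prob T m" using emm by (auto simp: emm_space_def)
  moreover have "radon_prob T \<mu>b" "Ent m \<mu>b < \<infinity>" using True by (auto simp: dom_E_def Pspace_def)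
  ultimately obtain \<delta> where \<delta>: "0 < \<delta>"
    "\<And>\<nu>. radon_prob T \<nu> \<Longrightarrow> W2 T d \<nu> \<mu>b < ennreal \<delta> \<Longrightarrow> ereal c < Ent m \<nu>"
    using Ent_W2_lsc c by metis
  have "((\<lambda>t. W2 T d (y t) \<mu>b) \<longlongrightarrow> 0) (at_right 0)" using flow True by (simp add: EVI_flow_def)
  hence "\<forall>\<^sub>F t in at_right 0. W2 T d (y t) \<mu>b < ennreal \<delta>" using \<delta>(1) by (intro order_tendstoD(2)) auto
  moreover have "\<forall>\<^sub>F t in at_right (0::real). 0 < t" by (simp add: eventually_at_right_less)
  ultimately show ?thesis
  proof eventually_elim
    case (elim t)
    thus ?case using flow \<delta>(2)[of "y t"] by (simp add: EVI_flow_def Pspace_def)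
  qed
next
  case False
  hence "Ent m \<mu>b \<le> Liminf (at_right 0) (\<lambda>t. Ent m (y t))" using flow by (simp add: EVI_flow_def)
  thus ?thesis using c less_LiminfD less_le_trans by blast
qed

text \<open>The integrated inequality is divided by \<open>J\<close> before integrating over z,
  which leaves nonnegative coefficients; with \<open>c\<close> nonnegative everything fits into
  \<open>ennreal\<close>.\<close>

private lemma flow_barycenter_bound:
  assumes flow: "EVI_flow (Pspace T) (W2 T d) (Ent m) K \<mu>b y"
    and c: "0 \<le> c" and lower: "\<forall>\<^sub>F t in at_right 0. ereal c \<le> Ent m (y t)"
    and V: "(\<integral>\<^sup>+\<mu>. W2sq T d \<mu> \<mu>b \<partial>\<Omega>) = ennreal v" "0 \<le> v"
    and E: "(\<integral>\<^sup>+\<mu>. e2ennreal (Ent m \<mu>) \<partial>\<Omega>) = ennreal e" "0 \<le> e"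
  shows "c \<le> e - K / 2 * v"
proof -
  obtain \<delta> where \<delta>: "0 < \<delta>" "\<And>t. 0 < t \<Longrightarrow> t < \<delta> \<Longrightarrow> ereal c \<le> Ent m (y t)"
    using lower unfolding eventually_at_right_field by auto
  \<comment> \<open>Any single time below \<delta> serves, since the resulting bound does not depend
    on it.\<close>
  define t where "t = \<delta> / 2"
  have t: "0 < t" "t < \<delta>" using \<delta>(1) by (auto simp: t_def)
  define J where "J = exp_primitive K t"
  have J: "0 < J" using exp_primitive_pos[OF t(1)] by (simp add: J_def)
  define X where "X = exp (K * t)"
  have KJ: "K * J = X - 1" by (simp add: J_def X_def exp_primitive_mult)
  have X: "0 < X" by (simp add: X_def)
  have yP: "y t \<in> Pspace T" using flow t(1) by (simp add: EVI_flow_def)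
  have pw: "ennreal (X / (2 * J)) * W2sq T d z (y t) + ennreal c
      \<le> ennreal (1 / (2 * J)) * W2sq T d z \<mu>b + e2ennreal (Ent m z)" if "z \<in> space \<Omega>" for z
  proof (cases "Ent m z < \<infinity> \<and> W2 T d z \<mu>b < \<infinity>")
    case True
    have z: "z \<in> Pspace T" using that space_Omega by simp
    have "0 \<le> Ent m z" using Ent_Pspace_nonneg[OF z] .
    then obtain a where a: "Ent m z = ereal a" "0 \<le> a" using True by (cases "Ent m z") auto
    have dz: "z \<in> dom_E (Pspace T) (Ent m)" using z True by (simp add: dom_E_def)
    have fb: "W2 T d \<mu>b z < \<infinity>" using True W2_sym[OF z bary_Pspace] by simp
    have ft: "W2 T d (y t) z < \<infinity>"
      by (rule EVI_flow_dist_finite[OF W2_metric bary_Pspace flow dz fb t(1)])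
    obtain p where p: "W2 T d \<mu>b z = ennreal p" "0 \<le> p" using fb by (cases "W2 T d \<mu>b z") auto
    obtain q where q: "W2 T d (y t) z = ennreal q" "0 \<le> q" using ft by (cases "W2 T d (y t) z") auto
    have "X * q\<^sup>2 / 2 + c * J \<le> p\<^sup>2 / 2 + a * J"
      using EVI_flow_integrated[OF W2_metric bary_Pspace flow \<delta>(2) dz a(1) fb t] p q
      by (simp add: X_def J_def)
    hence "(X * q\<^sup>2 / 2 + c * J) / J \<le> (p\<^sup>2 / 2 + a * J) / J" using J by (intro divide_right_mono) auto
    hence "X / (2 * J) * q\<^sup>2 + c \<le> 1 / (2 * J) * p\<^sup>2 + a" using J by (simp add: add_divide_distrib)
    hence "ennreal (X / (2 * J) * q\<^sup>2 + c) \<le> ennreal (1 / (2 * J) * p\<^sup>2 + a)" by (rule ennreal_leI)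
    moreover have "W2sq T d z (y t) = ennreal (q\<^sup>2)" "W2sq T d z \<mu>b = ennreal (p\<^sup>2)"
      using p q W2_sym[OF z yP] W2_sym[OF z bary_Pspace] by (auto simp: W2sq_eq ennreal_power)
    ultimately show ?thesis using J X c a p q by (simp add: ennreal_mult[symmetric] flip: ennreal_plus)
  next
    case False
    \<comment> \<open>One of the two terms on the right is infinite, and the coefficient of the
      distance is positive.\<close>
    hence "e2ennreal (Ent m z) = \<top> \<or> W2sq T d z \<mu>b = \<top>"
      by (auto simp: W2sq_eq power2_eq_square ennreal_top_mult less_top[symmetric])
    thus ?thesis using J by (auto simp: ennreal_mult_top)
  qed
  have [measurable]: "(\<lambda>\<mu>. W2sq T d \<mu> (y t)) \<in> borel_measurable \<Omega>" "(\<lambda>\<mu>. W2sq T d \<mu> \<mu>b) \<in> borel_measurable \<Omega>"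
    using W2sq_measurable yP bary_Pspace by auto
  \<comment> \<open>Minimality of the barycenter, tested against the competitor
    \<open>y t\<close>.\<close>
  have "ennreal v \<le> (\<integral>\<^sup>+\<mu>. W2sq T d \<mu> (y t) \<partial>\<Omega>)"
    using bary yP unfolding V(1)[symmetric] barycenter_def variance_def by (auto intro: INF_lower)
  hence "ennreal (X / (2 * J)) * ennreal v + ennreal c
      \<le> ennreal (X / (2 * J)) * (\<integral>\<^sup>+\<mu>. W2sq T d \<mu> (y t) \<partial>\<Omega>) + ennreal c"
    by (intro add_right_mono mult_left_mono) auto
  also have "\<dots> = (\<integral>\<^sup>+\<mu>. ennreal (X / (2 * J)) * W2sq T d \<mu> (y t) + ennreal c \<partial>\<Omega>)"
    using prob_space.emeasure_space_1[OF radon_prob_space(1)[OF \<Omega>_radon]]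
    by (simp add: nn_integral_add nn_integral_cmult)
  also have "\<dots> \<le> (\<integral>\<^sup>+\<mu>. ennreal (1 / (2 * J)) * W2sq T d \<mu> \<mu>b \<partial>\<Omega>) + (\<integral>\<^sup>+\<mu>. e2ennreal (Ent m \<mu>) \<partial>\<Omega>)"
    using pw V by (intro nn_integral_le_add_nonmeasurable) (auto simp: nn_integral_cmult ennreal_mult_less_top)
  also have "\<dots> = ennreal (1 / (2 * J)) * ennreal v + ennreal e"
    using V E by (simp add: nn_integral_cmult)
  finally have "X / (2 * J) * v + c \<le> 1 / (2 * J) * v + e"
    using J X V(2) E(2) c by (simp add: ennreal_mult[symmetric] flip: ennreal_plus)
  hence "(X - 1) / (2 * J) * v + c \<le> e" by (simp add: diff_divide_distrib left_diff_distrib)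
  moreover have "(X - 1) / (2 * J) = K / 2" using KJ J by (simp flip: KJ)
  ultimately show ?thesis by simp
qed

lemma Ent_barycenter_le:
  "Ent m \<mu>b \<le> ereal_integral \<Omega> (Ent m) - ereal (K / 2) * enn2ereal (\<integral>\<^sup>+ \<mu>. W2sq T d \<mu>b \<mu> \<partial>\<Omega>)"
proof -
  obtain v where v: "0 \<le> v" "(\<integral>\<^sup>+ \<mu>. W2sq T d \<mu> \<mu>b \<partial>\<Omega>) = ennreal v"
      "(\<integral>\<^sup>+ \<mu>. W2sq T d \<mu>b \<mu> \<partial>\<Omega>) = ennreal v"
    using W2sq_integral_finite by blast
  hence V: "enn2ereal (\<integral>\<^sup>+ \<mu>. W2sq T d \<mu>b \<mu> \<partial>\<Omega>) = ereal v" by (simp add: enn2ereal_ennreal)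
  have "(\<integral>\<^sup>+ \<mu>. e2ennreal (- Ent m \<mu>) \<partial>\<Omega>) = (\<integral>\<^sup>+ \<mu>. 0 \<partial>\<Omega>)"
    using Ent_Pspace_nonneg by (intro nn_integral_cong) (simp add: space_Omega e2ennreal_neg)
  hence I: "ereal_integral \<Omega> (Ent m) = enn2ereal (\<integral>\<^sup>+ \<mu>. e2ennreal (Ent m \<mu>) \<partial>\<Omega>)"
    by (simp add: ereal_integral_def zero_ennreal.rep_eq)
  show ?thesis
  proof (cases "\<integral>\<^sup>+ \<mu>. e2ennreal (Ent m \<mu>) \<partial>\<Omega>")
    case (real e)
    obtain y where flow: "EVI_flow (Pspace T) (W2 T d) (Ent m) K \<mu>b y"
      using barycenter_EVI_flow real by auto
    \<comment> \<open>A preliminary run with the lower bound 0 shows that the right-hand side is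
      nonnegative. Every \<open>c\<close> above it is then nonnegative, as
      \<open>flow_barycenter_bound\<close> requires.\<close>
    have "\<forall>\<^sub>F t in at_right 0. ereal 0 \<le> Ent m (y t)"
      using eventually_at_right_less[of "0::real"]
    proof eventually_elim
      case (elim t)
      thus ?case using flow Ent_Pspace_nonneg[of "y t"] by (simp add: EVI_flow_def zero_ereal_def)
    qed
    from flow_barycenter_bound[OF flow _ this v(2,1)] real have nonneg: "0 \<le> e - K / 2 * v" by simp
    have "Ent m \<mu>b \<le> ereal (e - K / 2 * v)"
    proof (rule ccontr)
      assume "\<not> ?thesis"
      hence "ereal (e - K / 2 * v) < Ent m \<mu>b" by (simp only: not_le)
      then obtain c where c: "ereal (e - K / 2 * v) < ereal c" "ereal c < Ent m \<mu>b"
        using ereal_dense2 by blast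
      have "\<forall>\<^sub>F t in at_right 0. ereal c \<le> Ent m (y t)"
        using flow_energy_lower[OF flow c(2)] by eventually_elim simp
      hence "c \<le> e - K / 2 * v"
        using flow_barycenter_bound[OF flow _ _ v(2,1), of c e] real nonneg c(1) by simp
      with c(1) show False by simp
    qed
    thus ?thesis using real by (simp add: I V enn2ereal_ennreal)
  next
    case top
    thus ?thesis by (simp add: I V top_ennreal.rep_eq)
  qed
qed

lemma Ent_barycenter_finite:
  assumes "ereal_integral \<Omega> (Ent m) < \<infinity>"
  shows "Ent m \<mu>b < \<infinity>"
proof -
  obtain v where "(\<integral>\<^sup>+ \<mu>. W2sq T d \<mu>b \<mu> \<partial>\<Omega>) = ennreal v" "0 \<le> v"
    using W2sq_integral_finite by blast
  thus ?thesis using Ent_barycenter_le assms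
    by (cases "ereal_integral \<Omega> (Ent m)") (auto simp: enn2ereal_ennreal)
qed

end

theorem theorem5p3:
  fixes K :: real
    and T :: "'a topology" and d :: "'a \<Rightarrow> 'a \<Rightarrow> ennreal" and m :: "'a measure"
    and S :: "'a measure topology" and \<Omega> :: "'a measure measure"
  assumes emm: "emm_space T d m"
    and S_top: "topspace S = Pspace T"
    and S_emt: "emt_space S (W2 T d)"
    and S_singletons: "\<forall>\<mu>\<in>Pspace T. {\<mu>} \<in> sets (borel_of S)"
    and \<Omega>_radon: "radon_prob S \<Omega>"
    and finite_var: "variance T d \<Omega> < \<infinity>"
    and EVI: "\<forall>\<mu>\<in>Pspace T. (\<exists>\<nu>\<in>Pspace T. Ent m \<nu> < \<infinity> \<and> W2 T d \<mu> \<nu> < \<infinity>) \<longrightarrow>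
                 (\<exists>y. EVI_flow (Pspace T) (W2 T d) (Ent m) K \<mu> y)"
  shows "(\<forall>\<mu>b. barycenter T d \<Omega> \<mu>b \<longrightarrow>
            Ent m \<mu>b \<le> ereal_integral \<Omega> (Ent m)
                        - ereal (K / 2) * enn2ereal (\<integral>\<^sup>+ \<mu>. W2sq T d \<mu>b \<mu> \<partial>\<Omega>))
         \<and> (ereal_integral \<Omega> (Ent m) < \<infinity> \<longrightarrow>
            (\<forall>\<mu>b. barycenter T d \<Omega> \<mu>b \<longrightarrow> absolutely_continuous m \<mu>b))"
proof (intro conjI impI allI)
  fix \<mu>b assume bary: "barycenter T d \<Omega> \<mu>b"
  show "Ent m \<mu>b \<le> ereal_integral \<Omega> (Ent m)
      - ereal (K / 2) * enn2ereal (\<integral>\<^sup>+ \<mu>. W2sq T d \<mu>b \<mu> \<partial>\<Omega>)"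
    by (rule Ent_barycenter_le[OF emm S_top S_emt \<Omega>_radon finite_var EVI bary])
next
  fix \<mu>b assume fin: "ereal_integral \<Omega> (Ent m) < \<infinity>" and bary: "barycenter T d \<Omega> \<mu>b"
  have "Ent m \<mu>b < \<infinity>"
    by (rule Ent_barycenter_finite[OF emm S_top S_emt \<Omega>_radon finite_var EVI bary fin])
  thus "absolutely_continuous m \<mu>b" by (auto simp: Ent_def split: if_splits)
qed

end
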